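(* Let $X$ be a Banach space over $\mathbb{K}$, let $N\in\mathbb{N}$, and let $z=\sum_{n=1}^\infty\lambda_n x_n^N\in\widehat{\otimes}_{\pi,s,N}X$, where $\lambda_n\in\mathbb{K}\setminus\{0\}$ for all $n$ and $(x_n)_{n=1}^\infty\subseteq S_X$. Then the following statements are equivalent. (1) $\|z\|_{\pi,s,N}=\sum_{n=1}^\infty|\lambda_n|$ (in other words, $z$ attains its norm, $z\in\mathrm{NA}_{\pi,s,N}(X)$, through this representation). (2) There exists $P\in\mathcal{P}({}^N X)$ with $\|P\|=1$ such that $P(x_n)=\mathrm{sign}(\lambda_n)$ for all $n\in\mathbb{N}$. (3) Every $P\in\mathcal{P}({}^N X)$ with $\|P\|=1$ and $P(z)=\|z\|_{\pi,s,N}$ satisfies $P(x_n)=\mathrm{sign}(\lambda_n)$ for all $n\in\mathbb{N}$.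
   Context: $\mathbb{K}$ is $\mathbb{R}$ or $\mathbb{C}$; $B_X$ and $S_X$ are the closed unit ball and unit sphere of $X$. For $\lambda\in\mathbb{C}\setminus\{0\}$, $\mathrm{sign}(\lambda):=\overline{\lambda}/|\lambda|$. For $z\in X$, $z^N:=z\otimes\cdots\otimes z$ ($N$ times). The $N$-fold projective symmetric tensor product $\widehat{\otimes}_{\pi,s,N}X$ is the completion of the linear span of $\{z^N:z\in X\}$ under the norm $\|z\|_{\pi,s,N}=\inf\{\sum_{k=1}^n|\lambda_k|: z=\sum_{k=1}^n\lambda_k x_k^N,\ n\in\mathbb{N},\ x_k\in S_X,\ \lambda_k\in\mathbb{K}\}$. $\mathrm{NA}_{\pi,s,N}(X)$ is the set of $z$ for which there are bounded sequences $(\mu_n)\subset\mathbb{K}$ and $(y_n)\subset B_X$ with $z=\sum_{n=1}^\infty\mu_n y_n^N$ and $\|z\|_{\pi,s,N}=\sum_{n=1}^\infty|\mu_n|$. $\mathcal{P}({}^N X)$ is the Banach space of continuous scalar-valued $N$-homogeneous polynomials on $X$ with $\|P\|=\sup_{x\in B_X}|P(x)|$; it is isometrically identified with $(\widehat{\otimes}_{\pi,s,N}X)^*$ via $\langle P,x^N\rangle=P(x)$, and $P(z)$ denotes this duality action for $z\in\widehat{\otimes}_{\pi,s,N}X$. *)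

theory Defs
  imports "HOL-Analysis.Analysis" "HOL-Library.Function_Algebras"
begin

text \<open>
  The scalar field \<open>K\<close> is \<open>\<real>\<close> or \<open>\<complex>\<close>: a field in this class is isometrically isomorphic, as a real
  algebra, to a subfield of the complex numbers containing the reals, and there are only two of those.
  Both are instances.
\<close>

class rc_field = real_normed_field + banach +
  fixes to_complex :: "'a \<Rightarrow> complex" and kconj :: "'a \<Rightarrow> 'a"
  assumes to_complex_add: "to_complex (x + y) = to_complex x + to_complex y"
    and to_complex_mult: "to_complex (x * y) = to_complex x * to_complex y"
    and to_complex_one: "to_complex 1 = 1"
    and to_complex_scaleR: "to_complex (scaleR r x) = complex_of_real r * to_complex x"
    and norm_to_complex: "cmod (to_complex x) = norm x"
    and to_complex_kconj: "to_complex (kconj x) = cnj (to_complex x)"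

instantiation real :: rc_field
begin
definition "to_complex (x :: real) = complex_of_real x"
definition "kconj (x :: real) = x"
instance by standard (simp_all add: to_complex_real_def kconj_real_def)
end

instantiation complex :: rc_field
begin
definition "to_complex (x :: complex) = x"
definition "kconj (x :: complex) = cnj x"
instance by standard (simp_all add: to_complex_complex_def kconj_complex_def scaleR_conv_of_real)
end

definition scalar_sign :: "'k::rc_field \<Rightarrow> 'k" where
  "scalar_sign c = kconj c / of_real (norm c)"

text \<open>
  A normed space over \<open>K\<close>; its addition, norm and (for \<open>banach\<close>) completeness come from the type.
  The axiom \<open>smul_of_real\<close> says that the real structure of the type is the restriction of the
  \<open>K\<close>-structure. (It also follows from the other axioms.)
\<close>

locale normed_space_over = vector_space smul
  for smul :: "'k::rc_field \<Rightarrow> 'a::real_normed_vector \<Rightarrow> 'a" +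
  assumes norm_smul: "norm (smul c x) = norm c * norm x"
    and smul_of_real: "smul (of_real r) x = r *\<^sub>R x"

text \<open>\<open>N\<close>-linear forms take a list of length \<open>N\<close>; their values on other lists are irrelevant.\<close>

definition multilinear_form :: "('k::rc_field \<Rightarrow> 'a::real_normed_vector \<Rightarrow> 'a) \<Rightarrow> nat \<Rightarrow> ('a list \<Rightarrow> 'k) \<Rightarrow> bool"
  where "multilinear_form smul N A \<longleftrightarrow>
    (\<forall>xs i. length xs = N \<and> i < N \<longrightarrow> Vector_Spaces.linear smul (*) (\<lambda>y. A (xs[i := y])))"

definition cont_hom_polys :: "('k::rc_field \<Rightarrow> 'a::real_normed_vector \<Rightarrow> 'a) \<Rightarrow> nat \<Rightarrow> ('a \<Rightarrow> 'k) set"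
  where "cont_hom_polys smul N =
    {P. continuous_on UNIV P \<and>
        (\<exists>A. multilinear_form smul N A \<and> (\<forall>x. P x = A (replicate N x)))}"

definition poly_norm :: "('a::real_normed_vector \<Rightarrow> 'k::rc_field) \<Rightarrow> real" where
  "poly_norm P = (SUP x\<in>cball 0 1. norm (P x))"

text \<open>
  The algebraic tensor product is realised inside the algebraic dual of the \<open>N\<close>-linear forms:
  \<open>x\<^sub>1 \<otimes> \<dots> \<otimes> x\<^sub>N\<close> is the evaluation \<open>A \<mapsto> A(x\<^sub>1, \<dots>, x\<^sub>N)\<close>. Since the functions in the type below
  are defined on all \<open>A\<close>, they are set to \<open>0\<close> off the \<open>N\<close>-linear forms. Sums and differences of
  tensors are pointwise.
\<close>

type_synonym ('a, 'k) tensor = "('a list \<Rightarrow> 'k) \<Rightarrow> 'k"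

definition elem_tensor :: "('k::rc_field \<Rightarrow> 'a::real_normed_vector \<Rightarrow> 'a) \<Rightarrow> nat \<Rightarrow> 'a list \<Rightarrow> ('a, 'k) tensor"
  where "elem_tensor smul N xs = (\<lambda>A. if multilinear_form smul N A then A xs else 0)"

definition tensor_power :: "('k::rc_field \<Rightarrow> 'a::real_normed_vector \<Rightarrow> 'a) \<Rightarrow> nat \<Rightarrow> 'a \<Rightarrow> ('a, 'k) tensor"
  where "tensor_power smul N x = elem_tensor smul N (replicate N x)"

definition tensor_scale :: "'k::rc_field \<Rightarrow> ('a, 'k) tensor \<Rightarrow> ('a, 'k) tensor" where
  "tensor_scale c t = (\<lambda>A. c * t A)"

lemma vector_space_tensor_scale: "vector_space tensor_scale"
  by unfold_locales (auto simp: tensor_scale_def fun_eq_iff algebra_simps)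

definition sym_tensors :: "('k::rc_field \<Rightarrow> 'a::real_normed_vector \<Rightarrow> 'a) \<Rightarrow> nat \<Rightarrow> ('a, 'k) tensor set"
  where "sym_tensors smul N = module.span tensor_scale (range (tensor_power smul N))"

definition pi_norm :: "('k::rc_field \<Rightarrow> 'a::real_normed_vector \<Rightarrow> 'a) \<Rightarrow> nat \<Rightarrow> ('a, 'k) tensor \<Rightarrow> real"
  where "pi_norm smul N t =
    Inf {(\<Sum>k<n. norm (c k)) | (n::nat) c x.
          (\<forall>k<n. x k \<in> sphere 0 1) \<and> t = (\<Sum>k<n. tensor_scale (c k) (tensor_power smul N (x k)))}"

text \<open>The completion consists of the classes of Cauchy sequences modulo null sequences.\<close>

definition pi_Cauchy :: "('k::rc_field \<Rightarrow> 'a::real_normed_vector \<Rightarrow> 'a) \<Rightarrow> nat \<Rightarrow> (nat \<Rightarrow> ('a, 'k) tensor) \<Rightarrow> bool"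
  where "pi_Cauchy smul N s \<longleftrightarrow> range s \<subseteq> sym_tensors smul N \<and>
    (\<forall>e>0. \<exists>M. \<forall>m\<ge>M. \<forall>n\<ge>M. pi_norm smul N (s m - s n) < e)"

definition pi_equiv :: "('k::rc_field \<Rightarrow> 'a::real_normed_vector \<Rightarrow> 'a) \<Rightarrow> nat \<Rightarrow>
    ((nat \<Rightarrow> ('a, 'k) tensor) \<times> (nat \<Rightarrow> ('a, 'k) tensor)) set"
  where "pi_equiv smul N = {(s, s'). pi_Cauchy smul N s \<and> pi_Cauchy smul N s' \<and>
    (\<lambda>n. pi_norm smul N (s n - s' n)) \<longlonglongrightarrow> 0}"

type_synonym ('a, 'k) ctensor = "(nat \<Rightarrow> ('a, 'k) tensor) set"

definition proj_sym_tensor :: "('k::rc_field \<Rightarrow> 'a::real_normed_vector \<Rightarrow> 'a) \<Rightarrow> nat \<Rightarrow> ('a, 'k) ctensor set"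
  where "proj_sym_tensor smul N = {s. pi_Cauchy smul N s} // pi_equiv smul N"

definition ctensor_of :: "('k::rc_field \<Rightarrow> 'a::real_normed_vector \<Rightarrow> 'a) \<Rightarrow> nat \<Rightarrow> ('a, 'k) tensor \<Rightarrow> ('a, 'k) ctensor"
  where "ctensor_of smul N t = pi_equiv smul N `` {\<lambda>_. t}"

definition ctensor_diff :: "('k::rc_field \<Rightarrow> 'a::real_normed_vector \<Rightarrow> 'a) \<Rightarrow> nat \<Rightarrow>
    ('a, 'k) ctensor \<Rightarrow> ('a, 'k) ctensor \<Rightarrow> ('a, 'k) ctensor"
  where "ctensor_diff smul N z w = (\<Union>s\<in>z. \<Union>s'\<in>w. pi_equiv smul N `` {\<lambda>n. s n - s' n})"

definition ctensor_norm :: "('k::rc_field \<Rightarrow> 'a::real_normed_vector \<Rightarrow> 'a) \<Rightarrow> nat \<Rightarrow> ('a, 'k) ctensor \<Rightarrow> real"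
  where "ctensor_norm smul N z = (THE r. \<forall>s\<in>z. (\<lambda>n. pi_norm smul N (s n)) \<longlonglongrightarrow> r)"

text \<open>\<open>z = (\<Sum>n. f n)\<close>: norm convergence of the partial sums in the completion.\<close>

definition ctensor_sums :: "('k::rc_field \<Rightarrow> 'a::real_normed_vector \<Rightarrow> 'a) \<Rightarrow> nat \<Rightarrow>
    (nat \<Rightarrow> ('a, 'k) tensor) \<Rightarrow> ('a, 'k) ctensor \<Rightarrow> bool"
  where "ctensor_sums smul N f z \<longleftrightarrow>
    (\<lambda>m. ctensor_norm smul N (ctensor_diff smul N z (ctensor_of smul N (\<Sum>n<m. f n)))) \<longlonglongrightarrow> 0"

text \<open>
  The duality action of a polynomial \<open>P\<close>: the linear extension of \<open>x\<^sup>N \<mapsto> P x\<close> to the span,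
  and then its continuous extension to the completion.
\<close>

definition poly_action :: "('k::rc_field \<Rightarrow> 'a::real_normed_vector \<Rightarrow> 'a) \<Rightarrow> nat \<Rightarrow> ('a \<Rightarrow> 'k) \<Rightarrow> ('a, 'k) tensor \<Rightarrow> 'k"
  where "poly_action smul N P t =
    (THE v. \<exists>(n::nat) c x. t = (\<Sum>k<n. tensor_scale (c k) (tensor_power smul N (x k))) \<and>
                  v = (\<Sum>k<n. c k * P (x k)))"

definition poly_duality :: "('k::rc_field \<Rightarrow> 'a::real_normed_vector \<Rightarrow> 'a) \<Rightarrow> nat \<Rightarrow> ('a \<Rightarrow> 'k) \<Rightarrow> ('a, 'k) ctensor \<Rightarrow> 'k"
  where "poly_duality smul N P z =
    (THE v. \<forall>s\<in>z. (\<lambda>n. poly_action smul N P (s n)) \<longlonglongrightarrow> v)"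

end

theory Submission
  imports Defs
begin

text \<open>
  For \<open>P\<close> of norm 1, \<open>P(z) = \<Sum> \<lambda>\<^sub>n P(x\<^sub>n)\<close>, with \<open>|\<lambda>\<^sub>n P(x\<^sub>n)| \<le> |\<lambda>\<^sub>n|\<close>. If the sum of the \<open>|\<lambda>\<^sub>n|\<close> is
  \<open>\<parallel>z\<parallel> = P(z)\<close>, comparing real parts gives \<open>\<lambda>\<^sub>n P(x\<^sub>n) = |\<lambda>\<^sub>n|\<close> for all \<open>n\<close>. Conversely, if
  \<open>P(x\<^sub>n) = sign \<lambda>\<^sub>n\<close>, then \<open>P\<close> shows that every partial sum of the series has norm
  \<open>\<Sum>\<^sub>n\<^sub><\<^sub>m |\<lambda>\<^sub>n|\<close>, and these norms tend to \<open>\<parallel>z\<parallel>\<close>. What connects the conditions is a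
  polynomial of norm 1 with \<open>P(z) = \<parallel>z\<parallel>\<close>, which the Hahn--Banach theorem provides: a functional on
  the symmetric tensors is the restriction of a linear functional \<open>F\<close> on all tensors, so
  \<open>x \<mapsto> F(x\<^sup>N)\<close> comes from the \<open>N\<close>-linear form \<open>F(x\<^sub>1 \<otimes> \<dots> \<otimes> x\<^sub>N)\<close>.
\<close>

section \<open>Sublinear functionals\<close>

locale rc_vector_space = vector_space smul
  for smul :: "'k::rc_field \<Rightarrow> 'v::ab_group_add \<Rightarrow> 'v"
begin

text \<open>Scaling is required as an inequality only: applied to \<open>c\<close> and to its
  inverse it yields equality, so a constructed functional needs half the check.\<close>

definition sublinear :: "('v \<Rightarrow> real) \<Rightarrow> bool" where
  "sublinear f \<longleftrightarrow> (\<forall>x y. f (x + y) \<le> f x + f y) \<and> (\<forall>c>0. \<forall>x. f (smul (of_real c) x) \<le> c * f x)"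

lemma sublinear_add: "sublinear f \<Longrightarrow> f (x + y) \<le> f x + f y"
  by (simp add: sublinear_def)

lemma sublinear_scale:
  assumes f: "sublinear f" and c: "c > 0"
  shows "f (smul (of_real c) x) = c * f x"
proof (rule antisym)
  show "f (smul (of_real c) x) \<le> c * f x"
    using assms by (simp add: sublinear_def)
  have "f (smul (of_real (inverse c)) (smul (of_real c) x)) \<le> inverse c * f (smul (of_real c) x)"
    using assms unfolding sublinear_def by (metis positive_imp_inverse_positive)
  moreover have "smul (of_real (inverse c)) (smul (of_real c) x) = x"
    using c by simp
  ultimately show "c * f x \<le> f (smul (of_real c) x)"
    using c by (simp add: field_simps)
qed

lemma sublinear_0:
  assumes "sublinear f"
  shows "f 0 = 0"
  using sublinear_scale[OF assms, of 2 0] by simp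

lemma sublinear_scale_nonneg: "sublinear f \<Longrightarrow> c \<ge> 0 \<Longrightarrow> f (smul (of_real c) x) = c * f x"
  using sublinear_scale[of f c x] sublinear_0[of f] by (cases "c = 0") auto

lemma sublinear_ge_uminus:
  assumes "sublinear f"
  shows "- f (- x) \<le> f x"
  using sublinear_add[OF assms, of x "- x"] sublinear_0[OF assms] by simp

text \<open>The witness \<open>q t\<close> is the infimum over a \<ge> 0 of lim f(t + a s_n) - a r.
  This is the classical lowering of \<open>f\<close> in one direction, where the direction is the
  ideal limit of \<open>s\<close> and \<open>r\<close> is the value of \<open>f\<close> there. The
  choices a = 0 and a = 1 give the last two conclusions.\<close>

lemma sublinear_tilt:
  assumes f: "sublinear f"
    and conv: "\<And>t a. a \<ge> 0 \<Longrightarrow> convergent (\<lambda>n::nat. f (t + smul (of_real a) (s n)))"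
    and r: "(\<lambda>n. f (s n)) \<longlonglongrightarrow> r"
  obtains q where "sublinear q" "\<And>t. q t \<le> f t"
    "\<And>t L. (\<lambda>n. f (t + s n)) \<longlonglongrightarrow> L \<Longrightarrow> q t \<le> L - r"
proof
  define g where "g t a = lim (\<lambda>n. f (t + smul (of_real a) (s n))) - a * r" for t a
  define q where "q t = (INF a\<in>{0..}. g t a)" for t
  have lim: "(\<lambda>n. f (t + smul (of_real a) (s n)) - a * r) \<longlonglongrightarrow> g t a" if "a \<ge> 0" for t a
    unfolding g_def using conv[OF that] by (intro tendsto_intros) (simp add: convergent_LIMSEQ_iff)
  \<comment> \<open>Subadditivity gives a f(s_n) \<le> f(t + a s_n) + f(-t), and a f(s_n) - a r
    tends to 0. The resulting bound is independent of a, so the infimum is finite.\<close>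
  have lower: "- f (- t) \<le> g t a" if "a \<ge> 0" for t a
  proof (rule LIMSEQ_le)
    show "(\<lambda>n. (a * f (s n) - f (- t)) - a * r) \<longlonglongrightarrow> - f (- t)"
      by (auto intro!: tendsto_eq_intros r)
    have "a * f (s n) - f (- t) \<le> f (t + smul (of_real a) (s n))" for n
      using sublinear_add[OF f, of "t + smul (of_real a) (s n)" "- t"]
        sublinear_scale_nonneg[OF f that, of "s n"] by simp
    then show "\<exists>N. \<forall>n\<ge>N. (a * f (s n) - f (- t)) - a * r \<le> f (t + smul (of_real a) (s n)) - a * r"
      by auto
  qed (rule lim[OF that])
  have bdd: "bdd_below (g t ` {0..})" for t
    using lower by (auto simp: bdd_below_def)
  have q_le: "q t \<le> g t a" if "a \<ge> 0" for t a
    unfolding q_def using that by (intro cINF_lower bdd) auto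
  have q_ge: "c \<le> q t" if "\<And>a. a \<ge> 0 \<Longrightarrow> c \<le> g t a" for c t
    unfolding q_def using that by (intro cINF_greatest) auto
  \<comment> \<open>Parameters add along with vectors, since a s_n + b s_n = (a + b) s_n; this makes
    the infimum over the parameter subadditive.\<close>
  have g_add: "g (t + u) (a + b) \<le> g t a + g u b" if "a \<ge> 0" "b \<ge> 0" for t u a b
  proof (rule LIMSEQ_le)
    show "(\<lambda>n. f (t + u + smul (of_real (a + b)) (s n)) - (a + b) * r) \<longlonglongrightarrow> g (t + u) (a + b)"
      using that by (intro lim) simp
    show "(\<lambda>n. (f (t + smul (of_real a) (s n)) - a * r) + (f (u + smul (of_real b) (s n)) - b * r)) \<longlonglongrightarrow> g t a + g u b"
      using that by (intro tendsto_add lim)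
    have "f (t + u + smul (of_real (a + b)) (s n)) \<le> f (t + smul (of_real a) (s n)) + f (u + smul (of_real b) (s n))" for n
      using sublinear_add[OF f, of "t + smul (of_real a) (s n)" "u + smul (of_real b) (s n)"]
      by (simp add: algebra_simps scale_left_distrib)
    then show "\<exists>N. \<forall>n\<ge>N. f (t + u + smul (of_real (a + b)) (s n)) - (a + b) * r
        \<le> (f (t + smul (of_real a) (s n)) - a * r) + (f (u + smul (of_real b) (s n)) - b * r)"
      by (auto simp: algebra_simps)
  qed
  have g_scale: "g (smul (of_real c) t) (c * a) = c * g t a" if "c > 0" "a \<ge> 0" for c t a
  proof (rule LIMSEQ_unique)
    show "(\<lambda>n. f (smul (of_real c) t + smul (of_real (c * a)) (s n)) - (c * a) * r) \<longlonglongrightarrow> g (smul (of_real c) t) (c * a)"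
      using that by (intro lim) simp
    have "f (smul (of_real c) t + smul (of_real (c * a)) (s n)) = c * f (t + smul (of_real a) (s n))" for n
      using sublinear_scale[OF f that(1), of "t + smul (of_real a) (s n)"] by (simp add: scale_right_distrib)
    moreover have "(\<lambda>n. c * (f (t + smul (of_real a) (s n)) - a * r)) \<longlonglongrightarrow> c * g t a"
      using that by (intro tendsto_mult_left lim)
    ultimately show "(\<lambda>n. f (smul (of_real c) t + smul (of_real (c * a)) (s n)) - (c * a) * r) \<longlonglongrightarrow> c * g t a"
      by (simp add: algebra_simps)
  qed
  show "sublinear q"
    unfolding sublinear_def
  proof (intro conjI allI impI)
    fix t u
    have "q (t + u) - g u b \<le> q t" if "b \<ge> 0" for b
    proof (rule q_ge)
      fix a :: real assume "a \<ge> 0"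
      then show "q (t + u) - g u b \<le> g t a"
        using q_le[of "a + b" "t + u"] g_add[of a b t u] that by simp
    qed
    then have "q (t + u) - q t \<le> q u"
      by (intro q_ge) (simp add: algebra_simps)
    then show "q (t + u) \<le> q t + q u" by simp
  next
    fix c :: real and t assume c: "c > 0"
    have "inverse c * q (smul (of_real c) t) \<le> q t"
    proof (rule q_ge)
      fix a :: real assume "a \<ge> 0"
      then show "inverse c * q (smul (of_real c) t) \<le> g t a"
        using q_le[of "c * a" "smul (of_real c) t"] g_scale[of c a t] c
        by (simp add: field_simps)
    qed
    then show "q (smul (of_real c) t) \<le> c * q t"
      using c by (simp add: field_simps)
  qed
  show "q t \<le> f t" for t
    using q_le[of 0 t] by (simp add: g_def)
  show "q t \<le> L - r" if "(\<lambda>n. f (t + s n)) \<longlonglongrightarrow> L" for t L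
    using q_le[of 1 t] limI[OF that] by (simp add: g_def)
qed

section \<open>Minimal sublinear functionals and real-linear minorants\<close>

lemma exists_minimal_sublinear:
  assumes p: "sublinear p"
  obtains f where "sublinear f" "\<And>x. f x \<le> p x"
    "\<And>q. sublinear q \<Longrightarrow> (\<And>x. q x \<le> f x) \<Longrightarrow> q = f"
proof -
  define S where "S = {f. sublinear f \<and> f \<le> p}"
  \<comment> \<open>The order is reversed, so the maximal element from Zorn's lemma is a minimal
    functional.\<close>
  define R where "R = (\<lambda>f g :: 'v \<Rightarrow> real. g \<le> f)"
  have "\<exists>m\<in>S. \<forall>q\<in>S. R m q \<longrightarrow> q = m"
  proof (rule predicate_Zorn)
    show "partial_order_on S (relation_of R S)"
      by (auto simp: partial_order_on_def preorder_on_def refl_on_def trans_on_def antisym_on_def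
          relation_of_def R_def intro: order_trans)
    fix C assume C: "C \<in> Chains (relation_of R S)"
    show "\<exists>u\<in>S. \<forall>a\<in>C. R a u"
    proof (cases "C = {}")
      case True
      then show ?thesis using p by (auto simp: S_def)
    next
      case False
      have CS: "f \<in> S" if "f \<in> C" for f
        using C that by (auto simp: Chains_def relation_of_def)
      have chain: "f \<le> g \<or> g \<le> f" if "f \<in> C" "g \<in> C" for f g
        using C that by (auto simp: Chains_def relation_of_def R_def)
      define h where "h x = (INF f\<in>C. f x)" for x
      \<comment> \<open>A lower bound common to the whole chain, which makes the pointwise infimum
        \<open>h\<close> finite.\<close>
      have "- p (- x) \<le> f x" if "f \<in> C" for f x
        using CS[OF that] sublinear_ge_uminus[of f x] by (auto simp: S_def le_fun_def intro: order_trans)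
          (smt (verit, ccfv_SIG))
      then have bdd: "bdd_below ((\<lambda>f. f x) ` C)" for x
        by (auto simp: bdd_below_def)
      have h_le: "h x \<le> f x" if "f \<in> C" for f x
        unfolding h_def using that by (intro cINF_lower bdd) auto
      have h_ge: "c \<le> h x" if "\<And>f. f \<in> C \<Longrightarrow> c \<le> f x" for c x
        unfolding h_def using that False by (intro cINF_greatest) auto
      \<comment> \<open>Of two comparable functionals the smaller can serve at both points; this is
        where the chain property enters.\<close>
      have hfg: "h (x + y) \<le> f x + g y" if fg: "f \<in> C" "g \<in> C" for f g x y
        using chain[OF fg]
      proof
        assume "f \<le> g"
        then show ?thesis
          using h_le[OF fg(1), of "x + y"] sublinear_add[of f x y] CS[OF fg(1)]
          by (simp add: S_def le_fun_def) (smt (verit))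
      next
        assume "g \<le> f"
        then show ?thesis
          using h_le[OF fg(2), of "x + y"] sublinear_add[of g x y] CS[OF fg(2)]
          by (simp add: S_def le_fun_def) (smt (verit))
      qed
      have "sublinear h"
        unfolding sublinear_def
      proof (intro conjI allI impI)
        fix x y
        have "h (x + y) - g y \<le> h x" if "g \<in> C" for g
          using hfg[OF _ that, of _ x y] by (intro h_ge) (simp add: algebra_simps)
        then have "h (x + y) - h x \<le> h y"
          by (intro h_ge) (simp add: algebra_simps)
        then show "h (x + y) \<le> h x + h y" by simp
      next
        fix c :: real and x assume c: "c > 0"
        have "inverse c * h (smul (of_real c) x) \<le> h x"
        proof (rule h_ge)
          fix f assume "f \<in> C"
          then show "inverse c * h (smul (of_real c) x) \<le> f x"
            using h_le[of f "smul (of_real c) x"] sublinear_scale[of f c x] CS[of f] c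
            by (simp add: field_simps S_def)
        qed
        then show "h (smul (of_real c) x) \<le> c * h x"
          using c by (simp add: field_simps)
      qed
      moreover have "h \<le> p"
        using False CS h_le by (fastforce simp: S_def le_fun_def intro: order_trans)
      ultimately show ?thesis
        using h_le by (intro bexI[of _ h]) (auto simp: S_def R_def le_fun_def)
    qed
  qed
  then obtain m where m: "m \<in> S" "\<And>q. q \<in> S \<Longrightarrow> q \<le> m \<Longrightarrow> q = m"
    by (auto simp: R_def)
  show ?thesis
  proof
    show "sublinear m" "\<And>x. m x \<le> p x"
      using m by (auto simp: S_def le_fun_def)
    show "q = m" if "sublinear q" "\<And>x. q x \<le> m x" for q
      using m that by (auto simp: S_def le_fun_def intro: order_trans)
  qed
qed

text \<open>A minimal sublinear functional is odd, and subadditivity at \<open>- x\<close> and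
  \<open>- y\<close> then reads as superadditivity. Minimality replaces the usual extension from
  subspace to subspace.\<close>

lemma exists_dominated_real_linear:
  assumes p: "sublinear p"
  obtains f where "\<And>x y. f (x + y) = f x + f y" "\<And>c x. f (smul (of_real c) x) = c * f x"
    "\<And>x. f x \<le> p x"
proof -
  obtain f where f: "sublinear f" "\<And>x. f x \<le> p x"
    and min: "\<And>q. sublinear q \<Longrightarrow> (\<And>x. q x \<le> f x) \<Longrightarrow> q = f"
    using exists_minimal_sublinear[OF p] by blast
  \<comment> \<open>Tilting \<open>f\<close> along the constant sequence \<open>x\<close> cannot decrease it, which forces \<open>f (- x) \<le> - f x\<close>.\<close>
  have neg: "f (- x) = - f x" for x
  proof -
    obtain q where q: "sublinear q" "\<And>t. q t \<le> f t"
      "\<And>t L. (\<lambda>n. f (t + x)) \<longlonglongrightarrow> L \<Longrightarrow> q t \<le> L - f x"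
      using sublinear_tilt[OF f(1), of "\<lambda>_. x" "f x"] by (auto simp: convergent_const)
    have "q (- x) \<le> f (- x + x) - f x"
      by (rule q(3)) simp
    moreover have "q = f"
      using q by (intro min)
    ultimately show ?thesis
      using sublinear_ge_uminus[OF f(1), of x] sublinear_0[OF f(1)] by simp
  qed
  show ?thesis
  proof
    show "f (x + y) = f x + f y" for x y
      using sublinear_add[OF f(1), of x y] sublinear_add[OF f(1), of "- x" "- y"] neg[of x] neg[of y]
        neg[of "x + y"] by simp
    show "f (smul (of_real c) x) = c * f x" for c x
    proof (cases "c \<ge> 0")
      case False
      then show ?thesis
        using sublinear_scale[OF f(1), of "- c" x] neg[of "smul (of_real c) x"] by simp
    qed (rule sublinear_scale_nonneg[OF f(1)])
  qed (rule f)
qed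

end

section \<open>Scalars\<close>

lemma to_complex_0 [simp]: "to_complex (0 :: 'k::rc_field) = 0"
  using to_complex_scaleR[of 0 "1::'k"] by simp

lemma to_complex_of_real [simp]: "to_complex (of_real r :: 'k::rc_field) = complex_of_real r"
  by (simp add: of_real_def to_complex_scaleR to_complex_one)

lemma to_complex_minus: "to_complex (- x :: 'k::rc_field) = - to_complex x"
  using to_complex_add[of x "- x"] by (simp add: add_eq_0_iff)

lemma to_complex_diff: "to_complex (x - y :: 'k::rc_field) = to_complex x - to_complex y"
  using to_complex_add[of x "- y"] by (simp add: to_complex_minus)

lemma to_complex_inject [simp]: "to_complex x = to_complex y \<longleftrightarrow> x = (y :: 'k::rc_field)"
  using norm_to_complex[of "x - y"] by (auto simp: to_complex_diff)

lemma bounded_linear_to_complex: "bounded_linear (to_complex :: 'k::rc_field \<Rightarrow> complex)"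
  by (rule bounded_linear_intro[of _ 1])
    (auto simp: to_complex_add to_complex_mult norm_to_complex scaleR_conv_of_real)

lemma Re_to_complex_le_norm: "Re (to_complex x) \<le> norm (x :: 'k::rc_field)"
  using complex_Re_le_cmod[of "to_complex x"] by (simp add: norm_to_complex)

text \<open>A real part that exhausts the bound on the modulus leaves nothing for the imaginary
  part.\<close>

lemma eq_of_real_norm_if_Re:
  fixes x :: "'k::rc_field"
  assumes "norm x \<le> r" "Re (to_complex x) \<ge> r"
  shows "x = of_real r"
proof -
  have "(Re (to_complex x))\<^sup>2 + (Im (to_complex x))\<^sup>2 \<le> r\<^sup>2" and r: "Re (to_complex x) = r"
    using assms Re_to_complex_le_norm[of x] power_mono[OF assms(1), of 2] cmod_power2[of "to_complex x"]
    by (auto simp: norm_to_complex)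
  then have "to_complex x = to_complex (of_real r)"
    by (simp add: complex_eq_iff)
  then show ?thesis by (rule iffD1[OF to_complex_inject])
qed

text \<open>An element with nonzero imaginary part, minus its real part and rescaled, is an
  imaginary unit. The dichotomy lets one proof cover both scalar fields.\<close>

lemma rc_field_cases:
  obtains (real) "\<And>x :: 'k::rc_field. x = of_real (Re (to_complex x))"
  | (complex) j :: "'k::rc_field" where "to_complex j = \<i>"
proof (cases "\<exists>x :: 'k. Im (to_complex x) \<noteq> 0")
  case True
  then obtain x :: 'k where x: "Im (to_complex x) \<noteq> 0" by blast
  have "to_complex ((x - of_real (Re (to_complex x))) /\<^sub>R Im (to_complex x)) = \<i>"
    using x by (simp add: to_complex_scaleR to_complex_diff complex_eq_iff Re_divide Im_divide field_simps power2_eq_square)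
  then show ?thesis by (rule complex)
next
  case False
  then have "to_complex x = to_complex (of_real (Re (to_complex x)) :: 'k)" for x :: 'k
    by (simp add: complex_eq_iff)
  then show ?thesis
    by (rule real[OF iffD1[OF to_complex_inject]])
qed

lemma scalar_sign_mult:
  assumes "c \<noteq> 0"
  shows "c * scalar_sign c = of_real (norm c)"
proof -
  have "to_complex (c * kconj c) = to_complex (of_real ((norm c)\<^sup>2) :: 'a)"
    using complex_norm_square[of "to_complex c"] by (simp add: to_complex_mult to_complex_kconj norm_to_complex flip: of_real_power)
  then have "c * kconj c = of_real ((norm c)\<^sup>2)"
    by (simp only: to_complex_inject)
  then show ?thesis
    using assms by (simp add: scalar_sign_def power2_eq_square)
qed

lemma norm_scalar_sign: "c \<noteq> 0 \<Longrightarrow> norm (scalar_sign c) = 1"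
  using arg_cong[OF scalar_sign_mult[of c], of norm] by (simp add: norm_mult)

lemma vector_space_mult: "vector_space ((*) :: 'k::field \<Rightarrow> 'k \<Rightarrow> 'k)"
  by unfold_locales (auto simp: algebra_simps)

section \<open>The Hahn--Banach theorem over the scalar field\<close>

context rc_vector_space
begin

section \<open>Seminorms, their Cauchy sequences and norming functionals\<close>

definition seminorm :: "('v \<Rightarrow> real) \<Rightarrow> bool" where
  "seminorm p \<longleftrightarrow> (\<forall>x y. p (x + y) \<le> p x + p y) \<and> (\<forall>c x. p (smul c x) = norm c * p x)"

lemma seminorm_sublinear: "seminorm p \<Longrightarrow> sublinear p"
  by (simp add: seminorm_def sublinear_def)

lemma seminorm_uminus: "seminorm p \<Longrightarrow> p (- x) = p x"
  unfolding seminorm_def by (metis norm_minus_cancel norm_one mult_1 scale_minus_left scale_one)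

lemma seminorm_minus_commute: "seminorm p \<Longrightarrow> p (x - y) = p (y - x)"
  using seminorm_uminus[of p "x - y"] by simp

lemma seminorm_nonneg: "seminorm p \<Longrightarrow> 0 \<le> p x"
  using sublinear_ge_uminus[OF seminorm_sublinear, of p x] by (simp add: seminorm_uminus)

lemma seminorm_diff_abs_le: "seminorm p \<Longrightarrow> \<bar>p x - p y\<bar> \<le> p (x - y)"
  using sublinear_add[OF seminorm_sublinear, of p "x - y" y] 
    sublinear_add[OF seminorm_sublinear, of p "y - x" x] seminorm_minus_commute[of p x y]
  by simp

lemma seminorm_triangle:
  assumes "seminorm p"
  shows "p (x - z) \<le> p (x - y) + p (y - z)"
  using sublinear_add[OF seminorm_sublinear[OF assms], of "x - y" "y - z"] by simp

definition seminorm_Cauchy :: "('v \<Rightarrow> real) \<Rightarrow> (nat \<Rightarrow> 'v) \<Rightarrow> bool" where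
  "seminorm_Cauchy p s \<longleftrightarrow> (\<forall>e>0. \<exists>M. \<forall>m\<ge>M. \<forall>n\<ge>M. p (s m - s n) < e)"

text \<open>A seminorm is 1-Lipschitz with respect to itself. The offset and the factor match the
  convergence hypothesis of \<open>sublinear_tilt\<close>.\<close>

lemma convergent_seminorm_Cauchy:
  assumes p: "seminorm p" and s: "seminorm_Cauchy p s"
  shows "convergent (\<lambda>n. p (t + smul c (s n)))"
proof (rule Cauchy_convergent, rule metric_CauchyI)
  fix e :: real assume "e > 0"
  define d where "d = e / (norm c + 1)"
  have "d > 0" using \<open>e > 0\<close> by (simp add: d_def add_nonneg_pos)
  then obtain M where M: "\<And>m n. m \<ge> M \<Longrightarrow> n \<ge> M \<Longrightarrow> p (s m - s n) < d"
    using s unfolding seminorm_Cauchy_def by blast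
  show "\<exists>M. \<forall>m\<ge>M. \<forall>n\<ge>M. dist (p (t + smul c (s m))) (p (t + smul c (s n))) < e"
  proof (intro exI[of _ M] allI impI)
    fix m n assume mn: "m \<ge> M" "n \<ge> M"
    have "dist (p (t + smul c (s m))) (p (t + smul c (s n))) \<le> p (smul c (s m - s n))"
      using seminorm_diff_abs_le[OF p, of "t + smul c (s m)" "t + smul c (s n)"]
      by (simp add: dist_real_def scale_right_diff_distrib)
    also have "\<dots> = norm c * p (s m - s n)"
      using p by (simp add: seminorm_def)
    also have "\<dots> \<le> norm c * d"
      using M[OF mn] by (intro mult_left_mono) auto
    also have "\<dots> < (norm c + 1) * d"
      using \<open>d > 0\<close> by (simp add: algebra_simps)
    also have "\<dots> = e"
      by (simp add: d_def) (smt (verit) norm_ge_zero)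
    finally show "dist (p (t + smul c (s m))) (p (t + smul c (s n))) < e" .
  qed
qed

text \<open>The inner limit is the distance from \<open>s m\<close> to the point of the completion
  that \<open>s\<close> represents.\<close>

lemma seminorm_Cauchy_lim_diff:
  assumes p: "seminorm p" and s: "seminorm_Cauchy p s"
  shows "(\<lambda>m. lim (\<lambda>n. p (s n - s m))) \<longlonglongrightarrow> 0"
proof (rule LIMSEQ_I)
  fix e :: real assume "e > 0"
  then obtain M where M: "\<And>m n. m \<ge> M \<Longrightarrow> n \<ge> M \<Longrightarrow> p (s m - s n) < e / 2"
    using s unfolding seminorm_Cauchy_def by (meson half_gt_zero)
  have "norm (lim (\<lambda>n. p (s n - s m)) - 0) < e" if "m \<ge> M" for m
  proof -
    have lim: "(\<lambda>n. p (s n - s m)) \<longlonglongrightarrow> lim (\<lambda>n. p (s n - s m))"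
      using convergent_seminorm_Cauchy[OF p s, of "- s m" 1] by (simp add: convergent_LIMSEQ_iff)
    have "lim (\<lambda>n. p (s n - s m)) \<le> e / 2"
      by (rule LIMSEQ_le_const2[OF lim]) (use M that in \<open>auto intro!: exI[of _ M] less_imp_le\<close>)
    moreover have "0 \<le> lim (\<lambda>n. p (s n - s m))"
      by (rule LIMSEQ_le_const[OF lim]) (simp add: seminorm_nonneg[OF p])
    ultimately show ?thesis using \<open>e > 0\<close> by simp
  qed
  then show "\<exists>M. \<forall>m\<ge>M. norm (lim (\<lambda>n. p (s n - s m)) - 0) < e" by blast
qed

text \<open>Over \<open>\<complex>\<close>, a real functional \<open>f\<close> is the real part of \<open>x \<mapsto> f x - i f (i x)\<close>.\<close>

lemma exists_scalar_linear_with_Re: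
  assumes add: "\<And>x y. f (x + y) = f x + f y" and scale: "\<And>c x. f (smul (of_real c) x) = c * f x"
  obtains F where "Vector_Spaces.linear smul (*) F" "\<And>x. Re (to_complex (F x)) = f x"
proof (cases rule: rc_field_cases[where ?'k = 'k])
  case real
  define F :: "'v \<Rightarrow> 'k" where "F x = of_real (f x)" for x
  have "F (smul c x) = c * F x" for c x
  proof -
    obtain a where "c = of_real a" using real[of c] by blast
    then show ?thesis by (simp add: F_def scale)
  qed
  then have "Vector_Spaces.linear smul (*) F"
    unfolding Vector_Spaces.linear_iff
    by (auto simp: F_def add vector_space_mult vector_space_axioms)
  then show ?thesis by (rule that) (simp add: F_def)
next
  case (complex j)
  define F :: "'v \<Rightarrow> 'k" where "F x = of_real (f x) - j * of_real (f (smul j x))" for x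
  have jj: "j * j = - 1"
    by (rule iffD1[OF to_complex_inject]) (simp del: to_complex_inject add: complex to_complex_mult to_complex_minus to_complex_one)
  \<comment> \<open>The field is spanned over the reals by 1 and \<open>j\<close>, so homogeneity
    has to be checked only for real scalars and for \<open>j\<close>.\<close>
  have decomp: "c = of_real (Re (to_complex c)) + j * of_real (Im (to_complex c))" for c
    by (rule iffD1[OF to_complex_inject])
      (simp del: to_complex_inject add: complex to_complex_add to_complex_mult complex_eq_iff)
  have uminus: "f (- x) = - f x" for x
    using scale[of "-1" x] by simp
  have F_add: "F (x + y) = F x + F y" for x y
    by (simp add: F_def add scale_right_distrib algebra_simps)
  have F_real: "F (smul (of_real a) x) = of_real a * F x" for a x
    using scale[of a "smul j x"] by (simp add: F_def scale mult.commute algebra_simps)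
  have F_j: "F (smul j x) = j * F x" for x
    by (simp add: F_def jj uminus algebra_simps flip: mult.assoc)
  have "F (smul c x) = c * F x" for c x
  proof -
    have "smul c x = smul (of_real (Re (to_complex c))) x + smul j (smul (of_real (Im (to_complex c))) x)"
      by (subst decomp[of c]) (simp only: scale_left_distrib scale_scale)
    also have "F \<dots> = of_real (Re (to_complex c)) * F x + j * (of_real (Im (to_complex c)) * F x)"
      by (simp only: F_add F_j F_real)
    also have "\<dots> = (of_real (Re (to_complex c)) + j * of_real (Im (to_complex c))) * F x"
      by (simp add: algebra_simps)
    also have "\<dots> = c * F x"
      by (subst (3) decomp[of c]) (rule refl)
    finally show ?thesis .
  qed
  then have "Vector_Spaces.linear smul (*) F"
    unfolding Vector_Spaces.linear_iff
    by (auto simp: F_add vector_space_mult vector_space_axioms)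
  then show ?thesis
    by (rule that) (simp add: F_def to_complex_diff to_complex_mult complex)
qed

text \<open>Multiplying \<open>x\<close> by the sign of \<open>F x\<close> makes the value real and
  nonnegative without changing \<open>p x\<close>.\<close>

lemma norm_le_seminorm_if_Re_le:
  assumes p: "seminorm p" and F: "Vector_Spaces.linear smul (*) F"
    and le: "\<And>x. Re (to_complex (F x)) \<le> p x"
  shows "norm (F x) \<le> p x"
proof (cases "F x = 0")
  case False
  define c where "c = scalar_sign (F x)"
  have c: "norm c = 1" "c * F x = of_real (norm (F x))"
    using norm_scalar_sign[OF False] scalar_sign_mult[OF False] by (simp_all add: c_def mult.commute)
  have "F (smul c x) = c * F x"
    using F by (simp add: Vector_Spaces.linear_iff)
  then have "norm (F x) \<le> p (smul c x)"
    using le[of "smul c x"] c by simp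
  then show ?thesis
    using p c by (simp add: seminorm_def)
qed (use seminorm_nonneg[OF p] in simp)

text \<open>
  The functional norms the limit of a Cauchy sequence, that is, a point of the completion, although
  it is constructed on the space itself: tilting \<open>p\<close> along the sequence plays the role of adding
  that point.
\<close>

lemma Hahn_Banach_norming:
  assumes p: "seminorm p" and s: "seminorm_Cauchy p s" and r: "(\<lambda>n. p (s n)) \<longlonglongrightarrow> r"
  obtains F where "Vector_Spaces.linear smul (*) F" "\<And>x. norm (F x) \<le> p x"
    "(\<lambda>n. F (s n)) \<longlonglongrightarrow> of_real r"
proof -
  obtain q where q: "sublinear q" "\<And>t. q t \<le> p t"
    "\<And>t L. (\<lambda>n. p (t + s n)) \<longlonglongrightarrow> L \<Longrightarrow> q t \<le> L - r"
    using sublinear_tilt[OF seminorm_sublinear[OF p] convergent_seminorm_Cauchy[OF p s] r] by metis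
  obtain f where f: "\<And>x y. f (x + y) = f x + f y" "\<And>c x. f (smul (of_real c) x) = c * f x"
    "\<And>x. f x \<le> q x"
    using exists_dominated_real_linear[OF q(1)] by metis
  obtain F where F: "Vector_Spaces.linear smul (*) F" "\<And>x. Re (to_complex (F x)) = f x"
    using exists_scalar_linear_with_Re[of f] f by metis
  have bound: "norm (F x) \<le> p x" for x
    using F f(3) q(2) by (intro norm_le_seminorm_if_Re_le[OF p]) (auto intro: order_trans)
  define e where "e m = lim (\<lambda>n. p (s n - s m))" for m
  have e: "e \<longlonglongrightarrow> 0"
    unfolding e_def by (rule seminorm_Cauchy_lim_diff[OF p s])
  \<comment> \<open>The tilt at the point \<open>- s m\<close> has limit \<open>e m\<close>, so -
    f(s_m) \<le> q(- s_m) \<le> e_m - r.\<close>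
  have low: "r - e m \<le> f (s m)" for m
  proof -
    have "(\<lambda>n. p (- s m + s n)) \<longlonglongrightarrow> e m"
      using convergent_seminorm_Cauchy[OF p s, of "- s m" 1]
      by (simp add: e_def convergent_LIMSEQ_iff)
    then show ?thesis
      using q(3)[of "- s m" "e m"] f(3)[of "- s m"] f(2)[of "-1" "s m"] by simp
  qed
  have "Cauchy (\<lambda>n. F (s n))"
  proof (rule metric_CauchyI)
    fix d :: real assume "d > 0"
    then obtain M where M: "\<And>m n. m \<ge> M \<Longrightarrow> n \<ge> M \<Longrightarrow> p (s m - s n) < d"
      using s unfolding seminorm_Cauchy_def by blast
    have "dist (F x) (F y) \<le> p (x - y)" for x y
      using bound[of "x - y"] module_hom.diff[OF F(1)[folded module_hom_iff_linear], of x y]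
      by (simp add: dist_norm)
    then show "\<exists>M. \<forall>m\<ge>M. \<forall>n\<ge>M. dist (F (s m)) (F (s n)) < d"
      using M by (meson le_less_trans)
  qed
  then obtain v where v: "(\<lambda>n. F (s n)) \<longlonglongrightarrow> v"
    by (auto simp: Cauchy_convergent_iff convergent_def)
  have "norm v \<le> r"
    by (rule LIMSEQ_le[OF tendsto_norm[OF v] r]) (simp add: bound)
  moreover have "r \<le> Re (to_complex v)"
  proof (rule LIMSEQ_le)
    show "(\<lambda>m. r - e m) \<longlonglongrightarrow> r"
      using tendsto_diff[OF tendsto_const e, of r] by simp
    show "(\<lambda>m. f (s m)) \<longlonglongrightarrow> Re (to_complex v)"
      using tendsto_Re[OF bounded_linear.tendsto[OF bounded_linear_to_complex v]] by (simp add: F(2))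
  qed (use low in blast)
  ultimately have "v = of_real r"
    by (rule eq_of_real_norm_if_Re)
  then show ?thesis
    using that F(1) bound v by blast
qed

end

section \<open>Continuity of bounded homogeneous polynomials\<close>

text \<open>Equivalence of norms on polynomials of degree at most \<open>d\<close>, by induction on
  the degree. The order of quantifiers matters: \<open>K\<close> depends on \<open>d\<close> alone,
  so one bound serves a whole family of polynomials.\<close>

lemma power_sum_coeff_bound:
  "\<exists>K\<ge>0. \<forall>(c :: nat \<Rightarrow> 'k::real_normed_field) M.
     (\<forall>t\<in>{0..1}. norm (\<Sum>i\<le>d. c i * of_real t ^ i) \<le> M) \<longrightarrow> (\<forall>i\<le>d. norm (c i) \<le> K * M)"
proof (induction d)
  case 0
  show ?case by (rule exI[of _ 1]) (auto dest: bspec[of _ _ 0])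
next
  case (Suc d)
  then obtain K where K: "K \<ge> 0"
    and bound: "\<And>(c :: nat \<Rightarrow> 'k) M i. (\<And>t. t \<in> {0..1} \<Longrightarrow> norm (\<Sum>i\<le>d. c i * of_real t ^ i) \<le> M)
       \<Longrightarrow> i \<le> d \<Longrightarrow> norm (c i) \<le> K * M"
    by blast
  \<comment> \<open>\<open>K\<close> is the constant for degree \<open>d\<close>; the other factor
    bounds the combination q(t) - 2^(d+1) q(t/2) to which it will be applied.\<close>
  define L where "L = K * (1 + 2 ^ Suc d)"
  have L: "L \<ge> 0" using K by (simp add: L_def)
  show ?case
  \<comment> \<open>\<open>L\<close> serves the coefficients up to \<open>d\<close> and the bracket
    serves the leading one, recovered from the value at 1; the sum covers both.\<close>
  proof (intro exI[of _ "L + (1 + of_nat (Suc d) * L)"] conjI allI impI)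
    show "0 \<le> L + (1 + of_nat (Suc d) * L)" using L by simp
    fix c :: "nat \<Rightarrow> 'k" and M i
    assume M: "\<forall>t\<in>{0..1}. norm (\<Sum>i\<le>Suc d. c i * of_real t ^ i) \<le> M" and i: "i \<le> Suc d"
    define q where "q t = (\<Sum>i\<le>Suc d. c i * of_real t ^ i)" for t :: real
    have qM: "norm (q t) \<le> M" if "t \<in> {0..1}" for t
      using M that by (simp add: q_def)
    have "M \<ge> 0" using qM[of 0] norm_ge_zero[of "q 0"] by (simp del: norm_ge_zero)
    have low: "norm (c i) \<le> L * M" if "i \<le> d" for i
    proof -
      have "norm ((1 - 2 ^ (Suc d - i)) * c i) \<le> K * (M + 2 ^ Suc d * M)"
      proof (rule bound[OF _ that])
        fix t :: real assume t: "t \<in> {0..1}"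
        have *: "(2::'k) ^ Suc d * (c i * of_real (t / 2) ^ i) = 2 ^ (Suc d - i) * c i * of_real t ^ i"
          if "i \<le> Suc d" for i
        proof -
          have "(2::'k) ^ Suc d = 2 ^ (Suc d - i) * 2 ^ i"
            using that by (simp flip: power_add)
          then show ?thesis by (simp add: power_divide field_simps)
        qed
        \<comment> \<open>Passing to \<open>q t - 2\<^sup>d\<^sup>+\<^sup>1 q (t / 2)\<close> cancels the leading coefficient.\<close>
        have "(\<Sum>i\<le>d. (1 - 2 ^ (Suc d - i)) * c i * of_real t ^ i)
            = (\<Sum>i\<le>Suc d. c i * of_real t ^ i - 2 ^ (Suc d - i) * c i * of_real t ^ i)"
          by (simp add: algebra_simps)
        also have "\<dots> = q t - 2 ^ Suc d * q (t / 2)"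
          unfolding q_def sum_subtractf sum_distrib_left by (intro arg_cong2[of _ _ _ _ minus] sum.cong) (simp_all only: * atMost_iff)
        finally have "norm (\<Sum>i\<le>d. (1 - 2 ^ (Suc d - i)) * c i * of_real t ^ i) \<le> norm (q t) + norm (2 ^ Suc d * q (t / 2))"
          by (metis norm_triangle_ineq4)
        also have "\<dots> \<le> M + 2 ^ Suc d * M"
          using qM[OF t] qM[of "t / 2"] t by (intro add_mono) (auto simp: norm_mult norm_power)
        finally show "norm (\<Sum>i\<le>d. (1 - 2 ^ (Suc d - i)) * c i * of_real t ^ i) \<le> M + 2 ^ Suc d * M" .
      qed
      moreover have "norm (c i) \<le> norm ((1 - 2 ^ (Suc d - i)) * c i)"
      proof -
        have "(2::real) ^ 1 \<le> 2 ^ (Suc d - i)"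
          using that by (intro power_increasing) auto
        moreover have "norm (1 - 2 ^ (Suc d - i) :: 'k) = \<bar>1 - 2 ^ (Suc d - i)\<bar>"
          using norm_of_real[of "1 - 2 ^ (Suc d - i)", where ?'a = 'k] by simp
        ultimately have "1 \<le> norm (1 - 2 ^ (Suc d - i) :: 'k)"
          by simp
        then show ?thesis
          unfolding norm_mult using mult_right_mono[OF _ norm_ge_zero, of 1] by fastforce
      qed
      ultimately show ?thesis by (simp add: L_def algebra_simps)
    qed
    have le: "L * M \<le> (L + (1 + of_nat (Suc d) * L)) * M" "(1 + of_nat (Suc d) * L) * M \<le> (L + (1 + of_nat (Suc d) * L)) * M"
      using L \<open>M \<ge> 0\<close> by (intro mult_right_mono; simp)+
    show "norm (c i) \<le> (L + (1 + of_nat (Suc d) * L)) * M"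
    proof (cases "i \<le> d")
      case True
      show ?thesis using order_trans[OF low[OF True] le(1)] .
    next
      case False
      then have "i = Suc d" using i by simp
      have "c (Suc d) = q 1 - (\<Sum>i\<le>d. c i)"
        by (simp add: q_def)
      then have "norm (c (Suc d)) \<le> norm (q 1) + norm (\<Sum>i\<le>d. c i)"
        by (metis norm_triangle_ineq4)
      also have "norm (\<Sum>i\<le>d. c i) \<le> of_nat (card {..d}) * (L * M)"
        using low by (intro sum_norm_bound) auto
      also have "norm (q 1) \<le> M" by (rule qM) simp
      finally have "norm (c (Suc d)) \<le> (1 + of_nat (Suc d) * L) * M"
        by (simp add: algebra_simps)
      then show ?thesis using le(2) \<open>i = Suc d\<close> by simp
    qed
  qed
qed

sublocale normed_space_over \<subseteq> rc_vector_space
  by unfold_locales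

section \<open>Multilinear forms on the diagonal and along lines\<close>

context normed_space_over
begin

lemma multilinear_form_add_at:
  assumes "multilinear_form smul N A" "length xs + Suc (length ys) = N"
  shows "A (xs @ (y + z) # ys) = A (xs @ y # ys) + A (xs @ z # ys)"
proof -
  have "Vector_Spaces.linear smul (*) (\<lambda>w. A ((xs @ y # ys)[length xs := w]))"
    using assms(1)[unfolded multilinear_form_def, rule_format, of "xs @ y # ys" "length xs"] assms(2) by simp
  then show ?thesis by (simp add: Vector_Spaces.linear_iff)
qed

lemma multilinear_form_scale_at:
  assumes "multilinear_form smul N A" "length xs + Suc (length ys) = N"
  shows "A (xs @ smul c y # ys) = c * A (xs @ y # ys)"
proof -
  have "Vector_Spaces.linear smul (*) (\<lambda>w. A ((xs @ y # ys)[length xs := w]))"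
    using assms(1)[unfolded multilinear_form_def, rule_format, of "xs @ y # ys" "length xs"] assms(2) by simp
  then show ?thesis by (simp add: Vector_Spaces.linear_iff)
qed

text \<open>The suffix is arbitrary so that each induction step can move one entry of the repeated
  block into it.\<close>

lemma multilinear_form_scale_prefix:
  assumes A: "multilinear_form smul N A"
  shows "k + length ys = N \<Longrightarrow> A (replicate k (smul c x) @ ys) = c ^ k * A (replicate k x @ ys)"
proof (induction k arbitrary: ys)
  case (Suc k)
  have "A (replicate k (smul c x) @ smul c x # ys) = c ^ k * A (replicate k x @ smul c x # ys)"
    using Suc by simp
  also have "\<dots> = c ^ k * (c * A (replicate k x @ x # ys))"
    using Suc.prems by (subst multilinear_form_scale_at[OF A]) auto
  finally show ?case
    by (simp add: replicate_app_Cons_same flip: mult.assoc)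
qed simp

lemma multilinear_form_power_scale:
  "multilinear_form smul N A \<Longrightarrow> A (replicate N (smul c x)) = c ^ N * A (replicate N x)"
  using multilinear_form_scale_prefix[of N A N "[]"] by simp

lemma multilinear_form_on_line_prefix:
  assumes A: "multilinear_form smul N A"
  shows "k + length ys = N \<Longrightarrow>
    \<exists>c. \<forall>t. A (replicate k (x + t *\<^sub>R u) @ ys) = (\<Sum>i\<le>k. c i * of_real t ^ i)"
proof (induction k arbitrary: ys)
  case 0
  then show ?case by (intro exI[of _ "\<lambda>_. A ys"]) simp
next
  case (Suc k)
  obtain c1 where c1: "\<And>t. A (replicate k (x + t *\<^sub>R u) @ x # ys) = (\<Sum>i\<le>k. c1 i * of_real t ^ i)"
    using Suc.IH[of "x # ys"] Suc.prems by auto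
  obtain c2 where c2: "\<And>t. A (replicate k (x + t *\<^sub>R u) @ u # ys) = (\<Sum>i\<le>k. c2 i * of_real t ^ i)"
    using Suc.IH[of "u # ys"] Suc.prems by auto
  \<comment> \<open>The slot just expanded contributes \<open>x\<close> or t times \<open>u\<close>,
    and the latter shifts degrees by one. The tests cut off \<open>c1\<close> above degree
    \<open>k\<close> and avoid the truncated subtraction at 0.\<close>
  define c where "c i = (if i \<le> k then c1 i else 0) + (if i = 0 then 0 else c2 (i - 1))" for i
  have "A (replicate (Suc k) (x + t *\<^sub>R u) @ ys) = (\<Sum>i\<le>Suc k. c i * of_real t ^ i)" for t
  proof -
    have "A (replicate (Suc k) (x + t *\<^sub>R u) @ ys) = A (replicate k (x + t *\<^sub>R u) @ (x + smul (of_real t) u) # ys)"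
      by (simp add: replicate_app_Cons_same smul_of_real)
    also have "\<dots> = A (replicate k (x + t *\<^sub>R u) @ x # ys) + of_real t * A (replicate k (x + t *\<^sub>R u) @ u # ys)"
      using Suc.prems by (simp add: multilinear_form_add_at[OF A] multilinear_form_scale_at[OF A])
    also have "\<dots> = (\<Sum>i\<le>k. c1 i * of_real t ^ i) + (\<Sum>i\<le>k. c2 i * of_real t ^ Suc i)"
      by (simp add: c1 c2 sum_distrib_left algebra_simps)
    also have "(\<Sum>i\<le>k. c1 i * of_real t ^ i) = (\<Sum>i\<le>Suc k. (if i \<le> k then c1 i else 0) * of_real t ^ i)"
      by simp
    also have "(\<Sum>i\<le>k. c2 i * of_real t ^ Suc i) = (\<Sum>i\<le>Suc k. (if i = 0 then 0 else c2 (i - 1)) * of_real t ^ i)"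
      by (subst sum.atMost_Suc_shift) simp
    finally show ?thesis
      by (simp only: c_def distrib_right sum.distrib)
  qed
  then show ?case by blast
qed

text \<open>
  The bound on the diagonal controls the coefficients of the polynomial
  \<open>t \<mapsto> A (x + t u, \<dots>, x + t u)\<close>, uniformly in \<open>u\<close>.
\<close>

lemma continuous_on_multilinear_power:
  assumes A: "multilinear_form smul N A" and bound: "\<And>x. norm (A (replicate N x)) \<le> norm x ^ N"
  shows "continuous_on UNIV (\<lambda>x. A (replicate N x))"
proof -
  obtain K where K: "K \<ge> 0"
    and coeff: "\<And>(c :: nat \<Rightarrow> 'k) M i. (\<And>t. t \<in> {0..1} \<Longrightarrow> norm (\<Sum>i\<le>N. c i * of_real t ^ i) \<le> M)
       \<Longrightarrow> i \<le> N \<Longrightarrow> norm (c i) \<le> K * M"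
    using power_sum_coeff_bound[of N, where ?'k = 'k] by blast
  \<comment> \<open>A local Lipschitz bound: the increment is a polynomial in t without constant
    term, and as t \<le> 1 each of its \<open>N\<close> terms is at most K (|x| + 1)^N t.\<close>
  have lip: "norm (A (replicate N (x + h)) - A (replicate N x)) \<le> (N * (K * (norm x + 1) ^ N)) * norm h"
    if h: "norm h \<le> 1" for x h
  proof -
    \<comment> \<open>A direction of norm at most 1, with the length kept in \<open>t\<close>, makes
      the coefficient bound the same for all \<open>h\<close>.\<close>
    define u where "u = sgn h"
    define t where "t = norm h"
    have t: "t \<in> {0..1}" using h by (simp add: t_def)
    obtain c where c: "\<And>t. A (replicate N (x + t *\<^sub>R u)) = (\<Sum>i\<le>N. c i * of_real t ^ i)"
      using multilinear_form_on_line_prefix[OF A, of N "[]" x u] by auto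
    have cb: "norm (c i) \<le> K * (norm x + 1) ^ N" if "i \<le> N" for i
    proof (rule coeff[OF _ that])
      fix t :: real assume "t \<in> {0..1}"
      then have "\<bar>t\<bar> * norm u \<le> 1 * 1"
        by (intro mult_mono) (auto simp: u_def norm_sgn)
      then have "norm (x + t *\<^sub>R u) \<le> norm x + 1"
        using norm_triangle_ineq[of x "t *\<^sub>R u"] by simp
      then have "norm (x + t *\<^sub>R u) ^ N \<le> (norm x + 1) ^ N"
        by (intro power_mono) auto
      then show "norm (\<Sum>i\<le>N. c i * of_real t ^ i) \<le> (norm x + 1) ^ N"
        using bound[of "x + t *\<^sub>R u"] by (simp add: c)
    qed
    have "x + h = x + t *\<^sub>R u"
      by (cases "h = 0") (simp_all add: t_def u_def sgn_div_norm)
    then have "A (replicate N (x + h)) - A (replicate N x) = (\<Sum>i\<le>N. c i * of_real t ^ i) - (\<Sum>i\<le>N. c i * of_real 0 ^ i)"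
      using c[of t] c[of 0] by simp
    also have "\<dots> = (\<Sum>i\<in>{1..N}. c i * of_real t ^ i)"
      by (simp add: sum.atMost_shift sum.atLeast1_atMost_eq)
    also have "norm \<dots> \<le> of_nat (card {1..N}) * (K * (norm x + 1) ^ N * norm h)"
    proof (rule sum_norm_bound)
      fix i assume i: "i \<in> {1..N}"
      have "t ^ i \<le> t ^ 1"
        using i t by (intro power_decreasing) auto
      then have "norm (c i) * t ^ i \<le> K * (norm x + 1) ^ N * t"
        using cb[of i] i K t by (intro mult_mono) auto
      then show "norm (c i * of_real t ^ i) \<le> K * (norm x + 1) ^ N * norm h"
        using t by (simp add: norm_mult norm_power t_def)
    qed
    finally show ?thesis by (simp add: mult.assoc)
  qed
  show ?thesis
    unfolding continuous_on_eq_continuous_at[OF open_UNIV]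
  proof (intro ballI)
    fix x
    have "((\<lambda>h. A (replicate N (x + h)) - A (replicate N x)) \<longlongrightarrow> 0) (at 0)"
    proof (rule Lim_null_comparison)
      show "\<forall>\<^sub>F h in at 0. norm (A (replicate N (x + h)) - A (replicate N x)) \<le> (N * (K * (norm x + 1) ^ N)) * norm h"
        unfolding eventually_at using lip by (intro exI[of _ 1]) auto
      show "((\<lambda>h. (N * (K * (norm x + 1) ^ N)) * norm h) \<longlongrightarrow> 0) (at 0)"
        by (intro tendsto_mult_right_zero tendsto_norm_zero) simp
    qed
    then show "isCont (\<lambda>x. A (replicate N x)) x"
      unfolding isCont_iff by (simp add: Lim_null[of "\<lambda>h. A (replicate N (x + h))"])
  qed
qed

end

section \<open>The projective norm on symmetric tensors\<close>

interpretation tensor: rc_vector_space tensor_scale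
  unfolding rc_vector_space_def by (rule vector_space_tensor_scale)

lemma sum_tensor_apply: "(\<Sum>k\<in>S. f k) A = (\<Sum>k\<in>S. f k A)" for f :: "'i \<Rightarrow> ('a, 'k::rc_field) tensor"
  by (induction S rule: infinite_finite_induct) auto

lemma tensor_scale_apply: "tensor_scale c t A = c * t A"
  by (simp add: tensor_scale_def)

text \<open>Linearity is inherited from the forms at which the tensor is evaluated; elsewhere the
  default value 0 keeps it true.\<close>

lemma linear_elem_tensor_slot:
  fixes smul :: "'k::rc_field \<Rightarrow> 'a::real_normed_vector \<Rightarrow> 'a"
  assumes "vector_space smul" "length xs = N" "i < N"
  shows "Vector_Spaces.linear smul tensor_scale (\<lambda>y. elem_tensor smul N (xs[i := y]))"
  using assms vector_space_tensor_scale
  by (auto simp: Vector_Spaces.linear_iff elem_tensor_def tensor_scale_def multilinear_form_def fun_eq_iff)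

text \<open>Half of the universal property of the tensor product: functionals pull back to
  multilinear forms.\<close>

lemma multilinear_form_elem_tensor:
  fixes smul :: "'k::rc_field \<Rightarrow> 'a::real_normed_vector \<Rightarrow> 'a"
  assumes "vector_space smul" "Vector_Spaces.linear tensor_scale (*) F"
  shows "multilinear_form smul N (\<lambda>xs. F (elem_tensor smul N xs))"
  unfolding multilinear_form_def
  using Vector_Spaces.linear_compose[OF linear_elem_tensor_slot[OF assms(1)] assms(2)]
  by (auto simp: o_def)

locale sym_tensor_power = normed_space_over smul
  for smul :: "'k::rc_field \<Rightarrow> 'a::real_normed_vector \<Rightarrow> 'a" +
  fixes N :: nat
  assumes N_pos: "N \<ge> 1"
begin

abbreviation pow where "pow \<equiv> tensor_power smul N"

lemma tensor_power_apply: "multilinear_form smul N A \<Longrightarrow> pow x A = A (replicate N x)"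
  by (simp add: tensor_power_def elem_tensor_def)

lemma tensor_power_smul: "pow (smul c x) = tensor_scale (c ^ N) (pow x)"
  by (auto simp: tensor_power_def elem_tensor_def tensor_scale_def fun_eq_iff multilinear_form_power_scale)

lemma tensor_power_0: "pow 0 = 0"
  using tensor_power_smul[of 0 0] N_pos by (simp add: power_0_left)

text \<open>Naming the set under the infimum lets properties of the norm be read off from operations
  on representations.\<close>

definition costs :: "('a, 'k) tensor \<Rightarrow> real set" where
  "costs t = {(\<Sum>k<n. norm (c k)) | (n::nat) c x.
     (\<forall>k<n. x k \<in> sphere 0 1) \<and> t = (\<Sum>k<n. tensor_scale (c k) (pow (x k)))}"

lemma pi_norm_eq_Inf_costs: "pi_norm smul N t = Inf (costs t)"
  by (simp add: pi_norm_def costs_def)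

lemma costsI:
  "(\<And>k. k < n \<Longrightarrow> norm (x k) = 1) \<Longrightarrow>
    (\<Sum>k<n. norm (c k)) \<in> costs (\<Sum>k<n. tensor_scale (c k) (pow (x k)))"
  for n :: nat
  by (auto simp: costs_def)

lemma costs_nonneg: "a \<in> costs t \<Longrightarrow> 0 \<le> a"
  by (auto simp: costs_def intro: sum_nonneg)

lemma zero_in_costs: "0 \<in> costs 0"
  using costsI[of 0 undefined undefined] by simp

lemma costs_scale:
  assumes "a \<in> costs t"
  shows "norm d * a \<in> costs (tensor_scale d t)"
proof -
  obtain n :: nat and c x where x: "\<And>k. k < n \<Longrightarrow> norm (x k) = 1"
    and t: "t = (\<Sum>k<n. tensor_scale (c k) (pow (x k)))" and a: "a = (\<Sum>k<n. norm (c k))"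
    using assms by (auto simp: costs_def)
  show ?thesis
    using costsI[of n x "\<lambda>k. d * c k"] x
    by (simp add: t a norm_mult sum_distrib_left tensor.scale_sum_right)
qed

lemma costs_add:
  assumes "a \<in> costs t" "b \<in> costs u"
  shows "a + b \<in> costs (t + u)"
proof -
  obtain n :: nat and c x where x: "\<And>k. k < n \<Longrightarrow> norm (x k) = 1"
    and t: "t = (\<Sum>k<n. tensor_scale (c k) (pow (x k)))" and a: "a = (\<Sum>k<n. norm (c k))"
    using assms(1) by (auto simp: costs_def)
  obtain m :: nat and d y where y: "\<And>k. k < m \<Longrightarrow> norm (y k) = 1"
    and u: "u = (\<Sum>k<m. tensor_scale (d k) (pow (y k)))" and b: "b = (\<Sum>k<m. norm (d k))"
    using assms(2) by (auto simp: costs_def)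
  \<comment> \<open>Concatenation: indices from \<open>n\<close> on refer to the second
    representation.\<close>
  define e where "e k = (if k < n then c k else d (k - n))" for k
  define w where "w k = (if k < n then x k else y (k - n))" for k
  have split: "sum f {..<n + m} = sum f {..<n} + (\<Sum>k<m. f (n + k))"
    for f :: "nat \<Rightarrow> 'b::comm_monoid_add"
    by (induction m) (simp_all add: add.assoc)
  have "(\<Sum>k<n + m. norm (e k)) = a + b"
    by (simp add: split[of "\<lambda>k. norm (e k)"] a b) (simp add: e_def)
  moreover have "(\<Sum>k<n + m. tensor_scale (e k) (pow (w k))) = t + u"
    by (simp add: split[of "\<lambda>k. tensor_scale (e k) (pow (w k))"] t u) (simp add: e_def w_def)
  moreover have "norm (w k) = 1" if "k < n + m" for k
    using that x[of k] y[of "k - n"] by (auto simp: w_def)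
  ultimately show ?thesis
    using costsI[of "n + m" w e] by simp
qed

text \<open>Normalising the vector pulls out the factor |x|^N; for the zero vector the empty
  representation serves, as N \<ge> 1.\<close>

lemma costs_tensor_power: "norm x ^ N \<in> costs (pow x)"
proof (cases "x = 0")
  case True
  then show ?thesis
    using zero_in_costs N_pos by (simp add: tensor_power_0 power_0_left)
next
  case False
  have "smul (of_real (norm x)) (sgn x) = x"
    using False by (simp add: smul_of_real sgn_div_norm)
  then have "tensor_scale (of_real (norm x) ^ N) (pow (sgn x)) = pow x"
    by (simp flip: tensor_power_smul)
  then show ?thesis
    using False costsI[of 1 "\<lambda>_. sgn x" "\<lambda>_. of_real (norm x) ^ N"] by (simp add: norm_sgn norm_power)
qed

abbreviation V where "V \<equiv> sym_tensors smul N"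

lemma subspace_sym_tensors: "tensor.subspace V"
  by (simp add: sym_tensors_def)

lemmas sym_tensors_closed =
  tensor.subspace_0[OF subspace_sym_tensors] tensor.subspace_add[OF subspace_sym_tensors]
  tensor.subspace_diff[OF subspace_sym_tensors] tensor.subspace_scale[OF subspace_sym_tensors]
  tensor.subspace_sum[OF subspace_sym_tensors]

lemma tensor_power_in: "pow x \<in> V"
  unfolding sym_tensors_def by (rule tensor.span_base) simp

text \<open>Lower bounds on the norm rest on this, since the infimum of an empty set of reals
  carries no information.\<close>

lemma costs_nonempty:
  assumes "t \<in> V"
  shows "costs t \<noteq> {}"
  using assms unfolding sym_tensors_def
proof (induction rule: tensor.span_induct_alt)
  case base
  then show ?case using zero_in_costs by blast
next
  case (step c u t)
  then show ?case
    using costs_add[OF costs_scale[OF costs_tensor_power]] by fast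
qed

lemma pi_norm_le_cost: "a \<in> costs t \<Longrightarrow> pi_norm smul N t \<le> a"
  unfolding pi_norm_eq_Inf_costs
  by (rule cInf_lower) (auto simp: bdd_below_def intro: costs_nonneg)

lemma le_pi_norm: "t \<in> V \<Longrightarrow> (\<And>a. a \<in> costs t \<Longrightarrow> b \<le> a) \<Longrightarrow> b \<le> pi_norm smul N t"
  unfolding pi_norm_eq_Inf_costs by (rule cInf_greatest) (use costs_nonempty in auto)

lemma pi_norm_nonneg: "t \<in> V \<Longrightarrow> 0 \<le> pi_norm smul N t"
  by (rule le_pi_norm) (auto intro: costs_nonneg)

lemma pi_norm_add:
  assumes "t \<in> V" "u \<in> V"
  shows "pi_norm smul N (t + u) \<le> pi_norm smul N t + pi_norm smul N u"
proof -
  have "pi_norm smul N (t + u) - b \<le> pi_norm smul N t" if "b \<in> costs u" for b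
    using pi_norm_le_cost[OF costs_add[OF _ that]] by (intro le_pi_norm[OF assms(1)]) (simp add: algebra_simps)
  then have "pi_norm smul N (t + u) - pi_norm smul N t \<le> pi_norm smul N u"
    by (intro le_pi_norm[OF assms(2)]) (simp add: algebra_simps)
  then show ?thesis by simp
qed

lemma pi_norm_0: "pi_norm smul N 0 = 0"
  using pi_norm_le_cost[OF zero_in_costs] pi_norm_nonneg[OF sym_tensors_closed(1)] by simp

lemma pi_norm_scale_le:
  assumes t: "t \<in> V"
  shows "pi_norm smul N (tensor_scale c t) \<le> norm c * pi_norm smul N t"
proof (cases "c = 0")
  case False
  have "pi_norm smul N (tensor_scale c t) / norm c \<le> pi_norm smul N t"
    using False pi_norm_le_cost[OF costs_scale, of _ t c] by (intro le_pi_norm t) (simp add: field_simps)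
  then show ?thesis using False by (simp add: field_simps)
qed (simp add: pi_norm_0)

lemma pi_norm_scale:
  assumes t: "t \<in> V"
  shows "pi_norm smul N (tensor_scale c t) = norm c * pi_norm smul N t"
proof (cases "c = 0")
  case False
  show ?thesis
    using pi_norm_scale_le[OF t, of c] pi_norm_scale_le[OF sym_tensors_closed(4)[OF t], of "inverse c" c] False
    by (intro antisym) (simp_all add: norm_divide field_simps)
qed (simp add: pi_norm_0)

lemma pi_norm_tensor_power: "pi_norm smul N (pow x) \<le> norm x ^ N"
  by (rule pi_norm_le_cost[OF costs_tensor_power])

text \<open>
  Composing with a linear projection onto the symmetric tensors makes the seminorm total, so that the
  functionals it dominates are defined on all tensors, in particular on \<open>x\<^sub>1 \<otimes> \<dots> \<otimes> x\<^sub>N\<close>.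
\<close>

lemma exists_seminorm_extending_pi_norm:
  obtains p where "tensor.seminorm p" "\<And>t. t \<in> V \<Longrightarrow> p t = pi_norm smul N t"
proof -
  interpret tp: vector_space_pair "tensor_scale :: 'k \<Rightarrow> ('a, 'k) tensor \<Rightarrow> ('a, 'k) tensor" tensor_scale
    by unfold_locales
  obtain g where g: "range g \<subseteq> V" "Vector_Spaces.linear tensor_scale tensor_scale g" "\<And>v. v \<in> V \<Longrightarrow> g v = v"
    using tp.linear_exists_left_inverse_on[OF tensor.linear_id subspace_sym_tensors] by auto
  have "tensor.seminorm (\<lambda>t. pi_norm smul N (g t))"
    using g(1,2) by (auto simp: tensor.seminorm_def Vector_Spaces.linear_iff intro!: pi_norm_add pi_norm_scale)
  then show ?thesis
    by (rule that) (simp add: g(3))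
qed

section \<open>Polynomials as functionals on the symmetric tensors\<close>

lemma norm_apply_le_pi_norm:
  assumes A: "multilinear_form smul N A" and B: "\<And>x. norm x = 1 \<Longrightarrow> norm (A (replicate N x)) \<le> B"
    and t: "t \<in> V" and "B \<ge> 0"
  shows "norm (t A) \<le> B * pi_norm smul N t"
proof -
  have cost: "norm (t A) \<le> B * a" if a: "a \<in> costs t" for a
  proof -
    obtain n :: nat and c x where x: "\<And>k. k < n \<Longrightarrow> norm (x k) = 1"
      and t: "t = (\<Sum>k<n. tensor_scale (c k) (pow (x k)))" and a: "a = (\<Sum>k<n. norm (c k))"
      using a by (auto simp: costs_def)
    have "norm (t A) \<le> (\<Sum>k<n. norm (c k * A (replicate N (x k))))"
      by (simp add: t sum_tensor_apply tensor_scale_apply tensor_power_apply[OF A] norm_sum)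
    also have "\<dots> \<le> (\<Sum>k<n. norm (c k) * B)"
      using B x by (intro sum_mono) (simp add: norm_mult mult_left_mono)
    finally show ?thesis by (simp add: a sum_distrib_left mult.commute)
  qed
  show ?thesis
  proof (cases "B = 0")
    case True
    then show ?thesis using cost costs_nonempty[OF t] by auto
  next
    case False
    then have "norm (t A) / B \<le> pi_norm smul N t"
      using cost \<open>B \<ge> 0\<close> by (intro le_pi_norm t) (simp add: field_simps)
    then show ?thesis using False \<open>B \<ge> 0\<close> by (simp add: field_simps)
  qed
qed

text \<open>Every representation, evaluated at \<open>A\<close>, gives the sum in the definition.
  Hence that sum does not depend on the representation, and the definite description is well
  defined.\<close>

lemma poly_action_eq:
  assumes A: "multilinear_form smul N A" and P: "\<And>x. P x = A (replicate N x)" and t: "t \<in> V"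
  shows "poly_action smul N P t = t A"
  unfolding poly_action_def
proof (rule the_equality)
  obtain a where "a \<in> costs t" using costs_nonempty[OF t] by auto
  then obtain n :: nat and c x where "t = (\<Sum>k<n. tensor_scale (c k) (pow (x k)))"
    by (auto simp: costs_def)
  moreover from this have "t A = (\<Sum>k<n. c k * P (x k))"
    by (simp add: P sum_tensor_apply tensor_scale_apply tensor_power_apply[OF A])
  ultimately show "\<exists>(n::nat) c x. t = (\<Sum>k<n. tensor_scale (c k) (pow (x k))) \<and> t A = (\<Sum>k<n. c k * P (x k))"
    by blast
next
  fix v assume "\<exists>(n::nat) c x. t = (\<Sum>k<n. tensor_scale (c k) (pow (x k))) \<and> v = (\<Sum>k<n. c k * P (x k))"
  then show "v = t A"
    by (auto simp: P sum_tensor_apply tensor_scale_apply tensor_power_apply[OF A])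
qed

text \<open>Both sides are linear in \<open>t\<close> and agree on powers, which span
  \<open>V\<close>. This identifies the action of the polynomial built from \<open>F\<close> with
  \<open>F\<close> itself.\<close>

lemma apply_multilinear_form_elem_tensor:
  assumes F: "Vector_Spaces.linear tensor_scale (*) F" and t: "t \<in> V"
  shows "t (\<lambda>xs. F (elem_tensor smul N xs)) = F t"
proof -
  have A: "multilinear_form smul N (\<lambda>xs. F (elem_tensor smul N xs))"
    by (rule multilinear_form_elem_tensor[OF vector_space_axioms F])
  have F': "F (tensor_scale c u + v) = c * F u + F v" "F 0 = 0" for c u v
    using F module_hom.zero[OF F[folded module_hom_iff_linear]] by (auto simp: Vector_Spaces.linear_iff)
  define ev where "ev v = v (\<lambda>xs. F (elem_tensor smul N xs))" for v :: "('a, 'k) tensor"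
  have "ev t = F t"
    using t unfolding sym_tensors_def
  proof (induction rule: tensor.span_induct_alt)
    case base
    show ?case unfolding F' by (simp add: ev_def)
  next
    case (step c u t)
    have "ev (tensor_scale c u + t) = c * ev u + ev t"
      by (simp add: ev_def tensor_scale_apply)
    moreover have "ev u = F u"
      using step.hyps tensor_power_apply[OF A] by (auto simp: ev_def tensor_power_def)
    ultimately have "ev (tensor_scale c u + t) = F (tensor_scale c u + t)"
      using step.IH by (simp only: F')
    then show ?case by blast
  qed
  then show ?thesis by (simp add: ev_def)
qed

text \<open>Continuity at 0 bounds \<open>P\<close> on a small ball, and homogeneity carries the
  bound to the unit ball. It makes the supremum in \<open>poly_norm\<close> a genuine one.\<close>

lemma poly_bdd_above:
  assumes P: "P \<in> cont_hom_polys smul N"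
  shows "bdd_above ((\<lambda>x. norm (P x)) ` cball 0 1)"
proof -
  obtain A where A: "multilinear_form smul N A" "\<And>x. P x = A (replicate N x)"
    and cont: "continuous_on UNIV P"
    using P by (auto simp: cont_hom_polys_def)
  have hom: "P (smul c x) = c ^ N * P x" for c x
    by (simp add: A multilinear_form_power_scale)
  have "P 0 = 0"
    using hom[of 0 0] N_pos by (simp add: power_0_left)
  moreover have "isCont P 0"
    using cont by (simp add: continuous_on_eq_continuous_at)
  ultimately obtain d where d: "d > 0" "\<And>x. norm x < d \<Longrightarrow> norm (P x) < 1"
    unfolding continuous_at_eps_delta by (metis diff_zero dist_norm zero_less_one)
  have "norm (P x) \<le> (2 / d) ^ N" if "norm x \<le> 1" for x
  proof -
    have "norm (smul (of_real (d / 2)) x) \<le> d / 2 * 1"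
      unfolding norm_smul using d(1) that by (intro mult_mono) auto
    then have "norm (P (smul (of_real (d / 2)) x)) \<le> 1"
      using d by (intro less_imp_le d(2)) auto
    then show ?thesis
      unfolding hom norm_mult norm_power using d(1) by (simp add: power_divide field_simps)
  qed
  then show ?thesis by (intro bdd_aboveI[of _ "(2 / d) ^ N"]) auto
qed

lemma norm_poly_le:
  assumes "P \<in> cont_hom_polys smul N" "norm x \<le> 1"
  shows "norm (P x) \<le> poly_norm P"
  unfolding poly_norm_def using assms by (intro cSUP_upper poly_bdd_above) auto

lemma poly_norm_le:
  assumes "\<And>x. norm x \<le> 1 \<Longrightarrow> norm (P x) \<le> B"
  shows "poly_norm P \<le> B"
  unfolding poly_norm_def using assms by (intro cSUP_least) auto

lemma cont_hom_polysE:
  assumes P: "P \<in> cont_hom_polys smul N"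
  obtains A where "multilinear_form smul N A" "\<And>x. P x = A (replicate N x)"
    "\<And>t. t \<in> V \<Longrightarrow> norm (t A) \<le> poly_norm P * pi_norm smul N t"
    "\<And>t. t \<in> V \<Longrightarrow> poly_action smul N P t = t A"
proof -
  obtain A where A: "multilinear_form smul N A" "\<And>x. P x = A (replicate N x)"
    using P by (auto simp: cont_hom_polys_def)
  have "0 \<le> poly_norm P"
    using order_trans[OF norm_ge_zero norm_poly_le[OF P, of 0]] by simp
  then have "norm (t A) \<le> poly_norm P * pi_norm smul N t" if "t \<in> V" for t
    using norm_poly_le[OF P] that by (intro norm_apply_le_pi_norm A) (simp_all flip: A(2))
  then show ?thesis
    using that A poly_action_eq[OF A] by blast
qed

text \<open>The converse half of the duality. The bound on \<open>V\<close> controls the induced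
  form only on the diagonal, so continuity comes from
  \<open>continuous_on_multilinear_power\<close>.\<close>

lemma cont_hom_poly_of_functional:
  assumes F: "Vector_Spaces.linear tensor_scale (*) F" and le: "\<And>t. t \<in> V \<Longrightarrow> norm (F t) \<le> pi_norm smul N t"
  shows "(\<lambda>x. F (pow x)) \<in> cont_hom_polys smul N" and "poly_norm (\<lambda>x. F (pow x)) \<le> 1"
    and "t \<in> V \<Longrightarrow> poly_action smul N (\<lambda>x. F (pow x)) t = F t"
proof -
  define A where "A xs = F (elem_tensor smul N xs)" for xs
  have A: "multilinear_form smul N A"
    unfolding A_def by (rule multilinear_form_elem_tensor[OF vector_space_axioms F])
  have P: "F (pow x) = A (replicate N x)" for x
    by (simp add: A_def tensor_power_def)
  have bound: "norm (A (replicate N x)) \<le> norm x ^ N" for x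
    using le[OF tensor_power_in, of x] pi_norm_tensor_power[of x] by (simp add: P)
  show "(\<lambda>x. F (pow x)) \<in> cont_hom_polys smul N"
    using A P continuous_on_multilinear_power[OF A bound] by (auto simp: cont_hom_polys_def)
  show "poly_norm (\<lambda>x. F (pow x)) \<le> 1"
    using order_trans[OF bound power_le_one] by (intro poly_norm_le) (simp add: P)
  show "poly_action smul N (\<lambda>x. F (pow x)) t = F t" if "t \<in> V"
    using poly_action_eq[OF A P that] apply_multilinear_form_elem_tensor[OF F that] by (simp add: A_def[abs_def])
qed

end

section \<open>The completion\<close>

context sym_tensor_power
begin

lemma pi_Cauchy_in: "pi_Cauchy smul N s \<Longrightarrow> s n \<in> V"
  by (auto simp: pi_Cauchy_def)

text \<open>\<open>pi_norm\<close> is known to be a seminorm only on \<open>V\<close>; its extension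
  to all tensors makes the general seminorm lemmas available.\<close>

lemma pi_norm_diff_abs_le:
  assumes "t \<in> V" "u \<in> V"
  shows "\<bar>pi_norm smul N t - pi_norm smul N u\<bar> \<le> pi_norm smul N (t - u)"
proof -
  obtain p where p: "tensor.seminorm p" "\<And>t. t \<in> V \<Longrightarrow> p t = pi_norm smul N t"
    using exists_seminorm_extending_pi_norm by blast
  show ?thesis
    using tensor.seminorm_diff_abs_le[OF p(1), of t u] assms sym_tensors_closed(3)[OF assms] by (simp add: p(2))
qed

lemma convergent_pi_norm_diff:
  assumes s: "pi_Cauchy smul N s" and t: "t \<in> V"
  shows "convergent (\<lambda>n. pi_norm smul N (s n - t))"
proof -
  obtain p where p: "tensor.seminorm p" "\<And>t. t \<in> V \<Longrightarrow> p t = pi_norm smul N t"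
    using exists_seminorm_extending_pi_norm by blast
  have "tensor.seminorm_Cauchy p s"
    using s sym_tensors_closed(3)[OF pi_Cauchy_in[OF s] pi_Cauchy_in[OF s]]
    by (simp add: tensor.seminorm_Cauchy_def pi_Cauchy_def p(2))
  from tensor.convergent_seminorm_Cauchy[OF p(1) this, of "- t" 1]
  show ?thesis
    using sym_tensors_closed(3)[OF pi_Cauchy_in[OF s] t] by (simp add: p(2))
qed

lemma pi_norm_limit_cong:
  assumes lim: "(\<lambda>n. pi_norm smul N (s n)) \<longlonglongrightarrow> r"
    and V: "\<And>n. s n \<in> V" "\<And>n. u n \<in> V"
    and diff: "(\<lambda>n. pi_norm smul N (s n - u n)) \<longlonglongrightarrow> 0"
  shows "(\<lambda>n. pi_norm smul N (u n)) \<longlonglongrightarrow> r"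
proof -
  have "(\<lambda>n. pi_norm smul N (s n) - pi_norm smul N (u n)) \<longlonglongrightarrow> 0"
    by (rule Lim_null_comparison[OF _ diff]) (simp add: pi_norm_diff_abs_le V)
  from tendsto_diff[OF lim this] show ?thesis by simp
qed

lemma pi_equiv_refl: "pi_Cauchy smul N s \<Longrightarrow> (s, s) \<in> pi_equiv smul N"
  by (simp add: pi_equiv_def pi_norm_0)

lemma pi_Cauchy_const: "t \<in> V \<Longrightarrow> pi_Cauchy smul N (\<lambda>_. t)"
  by (auto simp: pi_Cauchy_def pi_norm_0)

lemma pi_Cauchy_diff_const:
  assumes s: "pi_Cauchy smul N s" and t: "t \<in> V"
  shows "pi_Cauchy smul N (\<lambda>n. s n - t)"
  using s sym_tensors_closed(3)[OF pi_Cauchy_in[OF s] t]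
  by (auto simp: pi_Cauchy_def)

lemma ctensor_norm_eqI:
  assumes "z \<noteq> {}" and lim: "\<And>s. s \<in> z \<Longrightarrow> (\<lambda>n. pi_norm smul N (s n)) \<longlonglongrightarrow> r"
  shows "ctensor_norm smul N z = r"
  unfolding ctensor_norm_def
proof (rule the_equality)
  show "r' = r" if "\<forall>s\<in>z. (\<lambda>n. pi_norm smul N (s n)) \<longlonglongrightarrow> r'" for r'
    using assms that LIMSEQ_unique by (metis all_not_in_conv)
qed (use lim in blast)

lemma tendsto_ctensor_norm:
  assumes s: "pi_Cauchy smul N s"
  shows "(\<lambda>n. pi_norm smul N (s n)) \<longlonglongrightarrow> ctensor_norm smul N (pi_equiv smul N `` {s})"
proof -
  obtain r where r: "(\<lambda>n. pi_norm smul N (s n)) \<longlonglongrightarrow> r"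
    using convergent_pi_norm_diff[OF s sym_tensors_closed(1)] by (auto simp: convergent_def)
  have "ctensor_norm smul N (pi_equiv smul N `` {s}) = r"
  proof (rule ctensor_norm_eqI)
    show "pi_equiv smul N `` {s} \<noteq> {}" using pi_equiv_refl[OF s] by blast
    show "(\<lambda>n. pi_norm smul N (u n)) \<longlonglongrightarrow> r" if "u \<in> pi_equiv smul N `` {s}" for u
      using that pi_norm_limit_cong[OF r pi_Cauchy_in[OF s] pi_Cauchy_in]
      by (auto simp: pi_equiv_def)
  qed
  with r show ?thesis by simp
qed

text \<open>\<open>ctensor_diff\<close> unites classes over all pairs of representatives, so the
  limit has to be checked for every member of the union.\<close>

lemma tendsto_ctensor_norm_diff:
  assumes s: "pi_Cauchy smul N s" and t: "t \<in> V"
  shows "(\<lambda>n. pi_norm smul N (s n - t))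
    \<longlonglongrightarrow> ctensor_norm smul N (ctensor_diff smul N (pi_equiv smul N `` {s}) (ctensor_of smul N t))"
proof -
  obtain p where p: "tensor.seminorm p" "\<And>t. t \<in> V \<Longrightarrow> p t = pi_norm smul N t"
    using exists_seminorm_extending_pi_norm by blast
  obtain r where r: "(\<lambda>n. pi_norm smul N (s n - t)) \<longlonglongrightarrow> r"
    using convergent_pi_norm_diff[OF s t] by (auto simp: convergent_def)
  have "ctensor_norm smul N (ctensor_diff smul N (pi_equiv smul N `` {s}) (ctensor_of smul N t)) = r"
  proof (rule ctensor_norm_eqI)
    show "ctensor_diff smul N (pi_equiv smul N `` {s}) (ctensor_of smul N t) \<noteq> {}"
      using pi_equiv_refl[OF s] pi_equiv_refl[OF pi_Cauchy_const[OF t]]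
        pi_equiv_refl[OF pi_Cauchy_diff_const[OF s t]]
      unfolding ctensor_diff_def ctensor_of_def by blast
    fix u assume "u \<in> ctensor_diff smul N (pi_equiv smul N `` {s}) (ctensor_of smul N t)"
    then obtain s' t' where s': "(s, s') \<in> pi_equiv smul N" and t': "(\<lambda>_. t, t') \<in> pi_equiv smul N"
      and u: "(\<lambda>n. s' n - t' n, u) \<in> pi_equiv smul N"
      by (auto simp: ctensor_diff_def ctensor_of_def)
    have V: "s n \<in> V" "s' n \<in> V" "t' n \<in> V" "u n \<in> V" for n
      using s' t' u by (auto simp: pi_equiv_def intro: pi_Cauchy_in)
    note diffV = sym_tensors_closed(3)
    have lim: "(\<lambda>n. pi_norm smul N (s n - s' n) + pi_norm smul N (t - t' n) + pi_norm smul N (s' n - t' n - u n)) \<longlonglongrightarrow> 0"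
      using s' t' u by (intro tendsto_add_zero) (auto simp: pi_equiv_def)
    have bound: "norm (pi_norm smul N (s n - t - u n))
        \<le> pi_norm smul N (s n - s' n) + pi_norm smul N (t - t' n) + pi_norm smul N (s' n - t' n - u n)" for n
    proof -
      \<comment> \<open>Changing the two representatives, and then that of their difference, costs
        three null errors.\<close>
      have "s n - t - u n = (s n - s' n) - (t - t' n) + (s' n - t' n - u n)"
        by (simp add: algebra_simps)
      moreover have "p (a - b + c) \<le> p a + p b + p c" for a b c
        using tensor.sublinear_add[OF tensor.seminorm_sublinear[OF p(1)], of "a - b" c]
          tensor.seminorm_triangle[OF p(1), of a b 0] tensor.seminorm_uminus[OF p(1), of b]
        by simp
      ultimately show ?thesis
        using p(2) V t by (metis (no_types, lifting) diffV pi_norm_nonneg real_norm_def abs_of_nonneg)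
    qed
    have "(\<lambda>n. pi_norm smul N (s n - t - u n)) \<longlonglongrightarrow> 0"
      by (rule Lim_null_comparison[OF always_eventually[OF allI[OF bound]] lim])
    then show "(\<lambda>n. pi_norm smul N (u n)) \<longlonglongrightarrow> r"
      using V t by (intro pi_norm_limit_cong[OF r]) (auto intro: diffV)
  qed
  with r show ?thesis by simp
qed

text \<open>The action of \<open>P\<close> is Lipschitz with constant \<open>poly_norm P\<close>, so
  it sends Cauchy sequences to Cauchy sequences and equivalent ones to the same limit.\<close>

lemma tendsto_poly_duality:
  assumes P: "P \<in> cont_hom_polys smul N" and s: "pi_Cauchy smul N s"
  shows "(\<lambda>n. poly_action smul N P (s n)) \<longlonglongrightarrow> poly_duality smul N P (pi_equiv smul N `` {s})"
proof -
  obtain A where le: "\<And>t. t \<in> V \<Longrightarrow> norm (t A) \<le> poly_norm P * pi_norm smul N t"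
    and action: "\<And>t. t \<in> V \<Longrightarrow> poly_action smul N P t = t A"
    using cont_hom_polysE[OF P] by metis
  have diff: "norm (poly_action smul N P t - poly_action smul N P u) \<le> poly_norm P * pi_norm smul N (t - u)"
    if "t \<in> V" "u \<in> V" for t u
    using le[OF sym_tensors_closed(3)[OF that]] that by (simp add: action)
  have sV: "s n \<in> V" for n
    by (rule pi_Cauchy_in[OF s])
  have "Cauchy (\<lambda>n. poly_action smul N P (s n))"
  proof (rule metric_CauchyI)
    fix e :: real assume e: "e > 0"
    have B: "0 \<le> poly_norm P"
      using order_trans[OF norm_ge_zero norm_poly_le[OF P, of 0]] by simp
    with e have "e / (poly_norm P + 1) > 0" by simp
    then obtain M where M: "\<And>m n. m \<ge> M \<Longrightarrow> n \<ge> M \<Longrightarrow> pi_norm smul N (s m - s n) < e / (poly_norm P + 1)"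
      using s[unfolded pi_Cauchy_def, THEN conjunct2] by meson
    have "dist (poly_action smul N P (s m)) (poly_action smul N P (s n)) < e" if "m \<ge> M" "n \<ge> M" for m n
    proof -
      have "dist (poly_action smul N P (s m)) (poly_action smul N P (s n)) \<le> poly_norm P * pi_norm smul N (s m - s n)"
        unfolding dist_norm by (rule diff[OF sV sV])
      also have "\<dots> \<le> (poly_norm P + 1) * pi_norm smul N (s m - s n)"
        by (intro mult_right_mono pi_norm_nonneg sym_tensors_closed(3) sV) simp
      also have "\<dots> < e"
        using M[OF that] B by (simp add: field_simps)
      finally show ?thesis .
    qed
    then show "\<exists>M. \<forall>m\<ge>M. \<forall>n\<ge>M. dist (poly_action smul N P (s m)) (poly_action smul N P (s n)) < e"
      by blast
  qed
  then obtain v where v: "(\<lambda>n. poly_action smul N P (s n)) \<longlonglongrightarrow> v"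
    by (auto simp: Cauchy_convergent_iff convergent_def)
  have lim: "(\<lambda>n. poly_action smul N P (u n)) \<longlonglongrightarrow> v" if "u \<in> pi_equiv smul N `` {s}" for u
  proof -
    have u: "\<And>n. u n \<in> V" "(\<lambda>n. pi_norm smul N (s n - u n)) \<longlonglongrightarrow> 0"
      using that by (auto simp: pi_equiv_def intro: pi_Cauchy_in)
    have "(\<lambda>n. poly_action smul N P (s n) - poly_action smul N P (u n)) \<longlonglongrightarrow> 0"
    proof (rule Lim_null_comparison)
      show "(\<lambda>n. poly_norm P * pi_norm smul N (s n - u n)) \<longlonglongrightarrow> 0"
        using tendsto_mult_left[OF u(2), of "poly_norm P"] by simp
    qed (simp add: diff sV u)
    from tendsto_diff[OF v this] show ?thesis by simp
  qed
  have "poly_duality smul N P (pi_equiv smul N `` {s}) = v"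
    unfolding poly_duality_def
  proof (rule the_equality)
    have "s \<in> pi_equiv smul N `` {s}" using pi_equiv_refl[OF s] by blast
    then show "v' = v" if "\<forall>u\<in>pi_equiv smul N `` {s}. (\<lambda>n. poly_action smul N P (u n)) \<longlonglongrightarrow> v'" for v'
      using that v LIMSEQ_unique by blast
  qed (use lim in blast)
  with v show ?thesis by simp
qed

section \<open>Norming polynomials\<close>

lemma power_functional_in_cont_hom_polys:
  assumes f: "Vector_Spaces.linear smul (*) f" and le: "\<And>x. norm (f x) \<le> norm x"
  shows "(\<lambda>x. f x ^ N) \<in> cont_hom_polys smul N"
proof -
  define A where "A xs = (\<Prod>i<N. f (xs ! i))" for xs
  have f': "f (x + y) = f x + f y" "f (smul c x) = c * f x" for x y c
    using f by (simp_all add: Vector_Spaces.linear_iff)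
  \<comment> \<open>Changing one entry affects a single factor of the product, hence linearity in
    each slot.\<close>
  have "A (xs[i := y]) = f y * (\<Prod>j\<in>{..<N} - {i}. f (xs ! j))" if "length xs = N" "i < N" for xs i y
    unfolding A_def using that by (subst prod.remove[of _ i]) (auto intro!: prod.cong)
  then have "multilinear_form smul N A"
    by (auto simp: multilinear_form_def Vector_Spaces.linear_iff f' algebra_simps vector_space_mult vector_space_axioms)
  moreover have fA: "f x ^ N = A (replicate N x)" for x
    by (simp add: A_def)
  moreover have "continuous_on UNIV f"
  proof (rule bounded_linear.continuous_on[OF _ continuous_on_id])
    show "bounded_linear f"
      using f'(2)[of "of_real _"] le by (intro bounded_linear_intro[of _ 1]) (auto simp: f' smul_of_real scaleR_conv_of_real)
  qed
  ultimately show ?thesis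
    by (auto simp: cont_hom_polys_def simp flip: fA intro: continuous_intros)
qed

text \<open>A constant sequence represents the point itself, so \<open>Hahn_Banach_norming\<close>
  specialises to the classical statement.\<close>

lemma exists_norming_functional:
  assumes "x \<noteq> 0"
  obtains f where "Vector_Spaces.linear smul (*) f" "\<And>y. norm (f y) \<le> norm y" "f x = of_real (norm x)"
proof -
  have "seminorm norm"
    by (simp add: seminorm_def norm_smul norm_triangle_ineq)
  moreover have "seminorm_Cauchy norm (\<lambda>_. x)"
    by (simp add: seminorm_Cauchy_def)
  ultimately obtain f where "Vector_Spaces.linear smul (*) f" "\<And>y. norm (f y) \<le> norm y"
    "(\<lambda>n::nat. f x) \<longlonglongrightarrow> of_real (norm x)"
    using Hahn_Banach_norming[of norm "\<lambda>_. x" "norm x"] by auto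
  then show ?thesis
    using that by (simp add: LIMSEQ_const_iff)
qed

text \<open>The unit vector \<open>x\<close> records that the space is nonzero; on the zero space
  every such polynomial vanishes.\<close>

lemma exists_norming_poly:
  fixes x :: 'a
  assumes s: "pi_Cauchy smul N s" and x: "norm x = 1"
  defines "z \<equiv> pi_equiv smul N `` {s}"
  obtains P where "P \<in> cont_hom_polys smul N" "poly_norm P = 1"
    "poly_duality smul N P z = of_real (ctensor_norm smul N z)"
proof -
  note r = tendsto_ctensor_norm[OF s, folded z_def]
  have sV: "s n \<in> V" for n
    by (rule pi_Cauchy_in[OF s])
  show ?thesis
  proof (cases "ctensor_norm smul N z = 0")
    case True
    \<comment> \<open>A functional norming \<open>z\<close> may then be \<open>0\<close>, so it need not give a polynomial of norm 1.\<close>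
    obtain f where f: "Vector_Spaces.linear smul (*) f" "\<And>y. norm (f y) \<le> norm y" "f x = of_real (norm x)"
      using exists_norming_functional[of x] x by force
    define P where "P x = f x ^ N" for x
    have P: "P \<in> cont_hom_polys smul N"
      unfolding P_def[abs_def] by (rule power_functional_in_cont_hom_polys[OF f(1,2)])
    have "poly_norm P \<le> 1"
      using order_trans[OF f(2)] by (intro poly_norm_le) (auto simp: P_def norm_power intro: power_le_one)
    moreover have "1 \<le> poly_norm P"
      using norm_poly_le[OF P, of x] x f(3) by (simp add: P_def)
    moreover have "poly_duality smul N P z = 0"
    proof (rule LIMSEQ_unique[OF tendsto_poly_duality[OF P s, folded z_def]])
      obtain A where le: "\<And>t. t \<in> V \<Longrightarrow> norm (t A) \<le> poly_norm P * pi_norm smul N t"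
        and action: "\<And>t. t \<in> V \<Longrightarrow> poly_action smul N P t = t A"
        using cont_hom_polysE[OF P] by metis
      show "(\<lambda>n. poly_action smul N P (s n)) \<longlonglongrightarrow> 0"
      proof (rule Lim_null_comparison)
        show "(\<lambda>n. poly_norm P * pi_norm smul N (s n)) \<longlonglongrightarrow> 0"
          using tendsto_mult_left[OF r, of "poly_norm P"] True by simp
      qed (simp add: action le sV)
    qed
    ultimately show ?thesis
      using that[OF P] True by simp
  next
    case False
    obtain p where p: "tensor.seminorm p" "\<And>t. t \<in> V \<Longrightarrow> p t = pi_norm smul N t"
      using exists_seminorm_extending_pi_norm by blast
    have "tensor.seminorm_Cauchy p s"
      using s sym_tensors_closed(3)[OF sV sV]
      by (simp add: tensor.seminorm_Cauchy_def pi_Cauchy_def p(2))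
    moreover have "(\<lambda>n. p (s n)) \<longlonglongrightarrow> ctensor_norm smul N z"
      using r by (simp add: p(2) sV)
    ultimately obtain F where F: "Vector_Spaces.linear tensor_scale (*) F" "\<And>t. norm (F t) \<le> p t"
      "(\<lambda>n. F (s n)) \<longlonglongrightarrow> of_real (ctensor_norm smul N z)"
      using tensor.Hahn_Banach_norming[OF p(1)] by metis
    have FV: "norm (F t) \<le> pi_norm smul N t" if "t \<in> V" for t
      using F(2)[of t] p(2)[OF that] by simp
    define P where "P x = F (pow x)" for x
    have P: "P \<in> cont_hom_polys smul N" "poly_norm P \<le> 1" "\<And>t. t \<in> V \<Longrightarrow> poly_action smul N P t = F t"
      unfolding P_def[abs_def] using cont_hom_poly_of_functional[OF F(1) FV] by auto
    have dual: "poly_duality smul N P z = of_real (ctensor_norm smul N z)"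
      using LIMSEQ_unique[OF tendsto_poly_duality[OF P(1) s, folded z_def]] F(3) by (simp add: P(3) sV)
    obtain A where le: "\<And>t. t \<in> V \<Longrightarrow> norm (t A) \<le> poly_norm P * pi_norm smul N t"
      and action: "\<And>t. t \<in> V \<Longrightarrow> poly_action smul N P t = t A"
      using cont_hom_polysE[OF P(1)] by metis
    have r0: "0 \<le> ctensor_norm smul N z"
      using r by (rule LIMSEQ_le_const) (simp add: pi_norm_nonneg sV)
    \<comment> \<open>With r the norm of \<open>z\<close>, the limit of the bounds along
      \<open>s\<close> reads r \<le> ||P|| r, and r > 0 in this case.\<close>
    have "norm (of_real (ctensor_norm smul N z) :: 'k) \<le> poly_norm P * ctensor_norm smul N z"
    proof (rule LIMSEQ_le)
      show "(\<lambda>n. norm (F (s n))) \<longlonglongrightarrow> norm (of_real (ctensor_norm smul N z) :: 'k)"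
        by (intro tendsto_norm F)
      show "(\<lambda>n. poly_norm P * pi_norm smul N (s n)) \<longlonglongrightarrow> poly_norm P * ctensor_norm smul N z"
        by (intro tendsto_mult_left r)
    qed (use le action P(3) sV in auto)
    then have "1 \<le> poly_norm P"
      using r0 False by simp
    then show ?thesis
      using that[OF P(1)] P(2) dual by simp
  qed
qed

end

section \<open>The equality case for dominated series, and the equivalence\<close>

lemma sums_eq_imp_terms_of_real:
  fixes w :: "nat \<Rightarrow> 'k::rc_field"
  assumes b: "b sums r" and w: "w sums of_real r" and le: "\<And>n. norm (w n) \<le> b n"
  shows "w n = of_real (b n)"
proof -
  have "(\<lambda>n. Re (to_complex (w n))) sums r"
    using sums_Re[OF bounded_linear.sums[OF bounded_linear_to_complex w]] by simp
  \<comment> \<open>The differences are nonnegative and sum to 0, so each of them vanishes.\<close>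
  from sums_diff[OF b this] have d: "(\<lambda>n. b n - Re (to_complex (w n))) sums 0"
    by simp
  have nonneg: "0 \<le> b n - Re (to_complex (w n))" for n
    using order_trans[OF Re_to_complex_le_norm le] by simp
  have "b n - Re (to_complex (w n)) = 0"
    using suminf_eq_zero_iff[OF sums_summable[OF d] nonneg] sums_unique[OF d] by simp
  then show ?thesis
    using le[of n] by (intro eq_of_real_norm_if_Re) auto
qed

theorem lemma3p2:
  fixes smul :: "'k::rc_field \<Rightarrow> 'a::banach \<Rightarrow> 'a"
    and N :: nat
    and l :: "nat \<Rightarrow> 'k"
    and x :: "nat \<Rightarrow> 'a"
    and z :: "('a, 'k) ctensor"
  assumes "normed_space_over smul"
    and "N \<ge> 1"
    and "z \<in> proj_sym_tensor smul N"
    and "\<forall>n. l n \<noteq> 0"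
    and "\<forall>n. x n \<in> sphere 0 1"
    and "ctensor_sums smul N (\<lambda>n. tensor_scale (l n) (tensor_power smul N (x n))) z"
  shows "((\<lambda>n. norm (l n)) sums ctensor_norm smul N z
          \<longleftrightarrow> (\<exists>P\<in>cont_hom_polys smul N. poly_norm P = 1 \<and> (\<forall>n. P (x n) = scalar_sign (l n))))
       \<and> ((\<exists>P\<in>cont_hom_polys smul N. poly_norm P = 1 \<and> (\<forall>n. P (x n) = scalar_sign (l n)))
          \<longleftrightarrow> (\<forall>P\<in>cont_hom_polys smul N.
                 poly_norm P = 1 \<and> poly_duality smul N P z = of_real (ctensor_norm smul N z)
                 \<longrightarrow> (\<forall>n. P (x n) = scalar_sign (l n))))"
proof -
  interpret sym_tensor_power smul N
    using assms(1,2) by (simp add: sym_tensor_power_def sym_tensor_power_axioms_def)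
  have x: "norm (x n) = 1" for n
    using assms(5) by simp
  have l: "l n \<noteq> 0" for n
    using assms(4) by simp
  obtain s where s: "pi_Cauchy smul N s" and z: "z = pi_equiv smul N `` {s}"
    using assms(3) by (auto simp: proj_sym_tensor_def elim: quotientE)
  have sV: "s n \<in> V" for n
    by (rule pi_Cauchy_in[OF s])
  define S where "S m = (\<Sum>n<m. tensor_scale (l n) (pow (x n)))" for m
  have SV: "S m \<in> V" for m
    unfolding S_def by (intro sym_tensors_closed(4,5) tensor_power_in)
  define r where "r = ctensor_norm smul N z"
  have r: "(\<lambda>n. pi_norm smul N (s n)) \<longlonglongrightarrow> r"
    unfolding r_def z by (rule tendsto_ctensor_norm[OF s])
  define e where "e m = ctensor_norm smul N (ctensor_diff smul N z (ctensor_of smul N (S m)))" for m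
  have e: "e \<longlonglongrightarrow> 0"
    using assms(6) unfolding ctensor_sums_def S_def[symmetric] by (simp add: e_def[abs_def])
  have lim_e: "(\<lambda>n. pi_norm smul N (s n - S m)) \<longlonglongrightarrow> e m" for m
    unfolding e_def z by (rule tendsto_ctensor_norm_diff[OF s SV])
  \<comment> \<open>Passing to the limit along the representative \<open>s\<close> bounds the error
    by \<open>e m\<close>, the distance from the partial sum to \<open>z\<close>.\<close>
  have norm_S: "(\<lambda>m. pi_norm smul N (S m)) \<longlonglongrightarrow> r"
  proof -
    have "norm (pi_norm smul N (S m) - r) \<le> e m" for m
    proof (rule LIMSEQ_le)
      show "(\<lambda>n. \<bar>pi_norm smul N (S m) - pi_norm smul N (s n)\<bar>) \<longlonglongrightarrow> norm (pi_norm smul N (S m) - r)"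
        unfolding real_norm_def by (intro tendsto_intros r)
      show "\<exists>M. \<forall>n\<ge>M. \<bar>pi_norm smul N (S m) - pi_norm smul N (s n)\<bar> \<le> pi_norm smul N (s n - S m)"
        using pi_norm_diff_abs_le[OF sV SV] by (auto simp: abs_minus_commute)
    qed (rule lim_e)
    then have "(\<lambda>m. pi_norm smul N (S m) - r) \<longlonglongrightarrow> 0"
      by (intro Lim_null_comparison[OF _ e]) auto
    then show ?thesis by (simp add: LIM_zero_iff)
  qed
  \<comment> \<open>The same passage to the limit, with \<open>P\<close> 1-Lipschitz, shows that
    \<open>P\<close> may be applied to the series term by term.\<close>
  have dual: "(\<lambda>n. l n * P (x n)) sums poly_duality smul N P z"
    and partial: "\<And>m. norm (\<Sum>n<m. l n * P (x n)) \<le> pi_norm smul N (S m)"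
    if P: "P \<in> cont_hom_polys smul N" and P1: "poly_norm P = 1" for P
  proof -
    obtain A where A: "multilinear_form smul N A" "\<And>x. P x = A (replicate N x)"
      and le: "\<And>t. t \<in> V \<Longrightarrow> norm (t A) \<le> poly_norm P * pi_norm smul N t"
      and action: "\<And>t. t \<in> V \<Longrightarrow> poly_action smul N P t = t A"
      using cont_hom_polysE[OF P] by metis
    have SA: "S m A = (\<Sum>n<m. l n * P (x n))" for m
      by (simp add: S_def sum_tensor_apply tensor_scale_apply tensor_power_apply[OF A(1)] A(2))
    show "norm (\<Sum>n<m. l n * P (x n)) \<le> pi_norm smul N (S m)" for m
      using le[OF SV, of m] by (simp add: SA P1)
    have v: "(\<lambda>n. s n A) \<longlonglongrightarrow> poly_duality smul N P z"
      using tendsto_poly_duality[OF P s] by (simp add: action sV z)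
    have "norm (S m A - poly_duality smul N P z) \<le> e m" for m
    proof (rule LIMSEQ_le)
      show "(\<lambda>n. norm (S m A - s n A)) \<longlonglongrightarrow> norm (S m A - poly_duality smul N P z)"
        by (intro tendsto_intros v)
      show "\<exists>M. \<forall>n\<ge>M. norm (S m A - s n A) \<le> pi_norm smul N (s n - S m)"
        using le[OF sym_tensors_closed(3)[OF sV SV], of _ m] by (auto simp: P1 norm_minus_commute)
    qed (rule lim_e)
    then have "(\<lambda>m. S m A - poly_duality smul N P z) \<longlonglongrightarrow> 0"
      by (intro Lim_null_comparison[OF _ e]) auto
    then show "(\<lambda>n. l n * P (x n)) sums poly_duality smul N P z"
      by (simp add: LIM_zero_iff sums_def SA)
  qed
  \<comment> \<open>\<open>P0\<close> keeps the universally quantified condition from being vacuous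
    and is the witness for the existential one.\<close>
  obtain P0 where P0: "P0 \<in> cont_hom_polys smul N" "poly_norm P0 = 1" "poly_duality smul N P0 z = of_real r"
    using exists_norming_poly[OF s x[of 0]] by (auto simp: r_def z)
  have 12: "(\<lambda>n. norm (l n)) sums r"
    if P: "P \<in> cont_hom_polys smul N" "poly_norm P = 1" "\<forall>n. P (x n) = scalar_sign (l n)" for P
  proof -
    \<comment> \<open>The partial sum, as written, is a representation of this cost;
      \<open>P\<close> supplies the matching lower bound.\<close>
    have "pi_norm smul N (S m) = (\<Sum>n<m. norm (l n))" for m
    proof (rule antisym)
      show "pi_norm smul N (S m) \<le> (\<Sum>n<m. norm (l n))"
        unfolding S_def using x by (intro pi_norm_le_cost costsI)
      have "(\<Sum>n<m. l n * P (x n)) = of_real (\<Sum>n<m. norm (l n))"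
        by (simp add: P(3) scalar_sign_mult[OF l])
      then show "(\<Sum>n<m. norm (l n)) \<le> pi_norm smul N (S m)"
        using partial[OF P(1,2), of m] by (simp only: norm_of_real)
    qed
    then show ?thesis using norm_S by (simp add: sums_def)
  qed
  have 13: "P (x n) = scalar_sign (l n)"
    if sums: "(\<lambda>n. norm (l n)) sums r"
      and P: "P \<in> cont_hom_polys smul N" "poly_norm P = 1" "poly_duality smul N P z = of_real r" for P n
  proof -
    \<comment> \<open>Domination of each term by \<open>norm (l n)\<close>, with equal sums, puts
      the series in the equality case.\<close>
    have "norm (l n * P (x n)) \<le> norm (l n)" for n
      using mult_left_mono[OF norm_poly_le[OF P(1), of "x n"] norm_ge_zero[of "l n"]] x P(2)
      by (simp add: norm_mult)
    then have "l n * P (x n) = l n * scalar_sign (l n)"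
      unfolding scalar_sign_mult[OF l]
      using dual[OF P(1,2)] P(3) by (intro sums_eq_imp_terms_of_real[OF sums]) auto
    then show ?thesis using l by simp
  qed
  \<comment> \<open>The cycle closes: (1) gives (3) by \<open>13\<close>, (3) gives (2) through
    \<open>P0\<close>, and (2) gives (1) by \<open>12\<close>.\<close>
  show ?thesis
    unfolding r_def[symmetric] using P0 12 13 by blast
qed

end
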